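(* For each $F_{\sigma\delta}$-set $A$ in a compact one-dimensional metrizable space $X$, there is an embedding $h : X \to (\mathbb{P} \cup \{0\})^{\mathbb{N}} \cup \mathbb{Q}^{\mathbb{N}}$ such that $A = h^{-1}(H)$, where $$H = \bigcap_{k} \bigcup_{l} H_{kl}, \qquad H_{kl} = \{ x \in I^{\mathbb{N}} : x(2^k 3^l) = 0 \},$$ with $k, l$ ranging over $\mathbb{N}$.
   Context: All spaces are separable and metrizable; dimension is the usual topological dimension $\dim$. Let $I = [0,1]$, let $\mathbb{P}$ denote the set of irrational numbers in $[0,1]$ and $\mathbb{Q}$ the set of rational numbers in $[0,1]$ (so $0,1 \in \mathbb{Q}$), and $\mathbb{N} = \{1,2,3,\ldots\}$. The countable products $(\mathbb{P} \cup \{0\})^{\mathbb{N}}$ and $\mathbb{Q}^{\mathbb{N}}$ are regarded as subspaces of the Hilbert cube $I^{\mathbb{N}}$ (product topology), their union has the subspace topology from $I^{\mathbb{N}}$, and $x(n)$ denotes the $n$-th coordinate of $x \in I^{\mathbb{N}}$. An $F_{\sigma\delta}$-set is a countable intersection of countable unions of closed sets. An embedding is a homeomorphism onto its image. *)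

theory Defs
  imports "HOL-Analysis.Analysis"
begin

text \<open>
  Lebesgue covering dimension, in the form used for normal spaces: every finite open cover has a
  finite open refinement in which any more than \<open>n + 1\<close> distinct members have empty intersection.
  The bound is an integer so that dimension \<open>-1\<close> (the empty space) is included. For \<open>n \<le> -2\<close> the
  predicate is false, because the empty subfamily has the intersection \<^term>\<open>UNIV\<close>.
\<close>

definition covering_dim_le :: "'a topology \<Rightarrow> int \<Rightarrow> bool" where
  "covering_dim_le X n \<longleftrightarrow>
     (\<forall>\<U>. finite \<U> \<and> (\<forall>U\<in>\<U>. openin X U) \<and> \<Union>\<U> = topspace X \<longrightarrow>
       (\<exists>\<V>. finite \<V> \<and> (\<forall>V\<in>\<V>. openin X V) \<and> \<Union>\<V> = topspace X \<and>
            (\<forall>V\<in>\<V>. \<exists>U\<in>\<U>. V \<subseteq> U) \<and>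
            (\<forall>\<F>. \<F> \<subseteq> \<V> \<and> int (card \<F>) > n + 1 \<longrightarrow> \<Inter>\<F> = {})))"

definition has_covering_dim :: "'a topology \<Rightarrow> int \<Rightarrow> bool" where
  "has_covering_dim X n \<longleftrightarrow> covering_dim_le X n \<and> \<not> covering_dim_le X (n - 1)"

definition fsigmadelta_in :: "'a topology \<Rightarrow> 'a set \<Rightarrow> bool" where
  "fsigmadelta_in X = (countable intersection_of fsigma_in X) relative_to topspace X"

text \<open>
  Coordinates are indexed by the positive integers \<open>{1..}\<close>; as usual for
  \<^const>\<open>product_topology\<close>, points are functions with the value \<^const>\<open>undefined\<close> at \<open>0\<close>.
\<close>

definition hilbert_cube :: "(nat \<Rightarrow> real) topology" where
  "hilbert_cube = product_topology (\<lambda>_. top_of_set {0..1}) {1..}"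

definition unit_irrationals :: "real set" where
  "unit_irrationals = {0..1} - \<rat>"

definition unit_rationals :: "real set" where
  "unit_rationals = {0..1} \<inter> \<rat>"

definition irrational_or_zero_points :: "(nat \<Rightarrow> real) set" where
  "irrational_or_zero_points = (\<Pi>\<^sub>E n\<in>{1..}. unit_irrationals \<union> {0})"

definition rational_points :: "(nat \<Rightarrow> real) set" where
  "rational_points = (\<Pi>\<^sub>E n\<in>{1..}. unit_rationals)"

definition Hkl :: "nat \<Rightarrow> nat \<Rightarrow> (nat \<Rightarrow> real) set" where
  "Hkl k l = {x \<in> topspace hilbert_cube. x (2 ^ k * 3 ^ l) = 0}"

definition H :: "(nat \<Rightarrow> real) set" where
  "H = (\<Inter>k\<in>{1..}. \<Union>l\<in>{1..}. Hkl k l)"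

end

theory Submission
  imports Defs
begin

text \<open>
  A one-dimensional compact metrizable space has a countable family of pairwise disjoint compact
  zero-dimensional sets \<open>L i\<close> such that any closed set is separated from the complement of any open
  neighbourhood by a partition that is a clopen piece of finitely many of the \<open>L i\<close>. Let \<open>E\<close> be
  their union. For every closed \<open>F\<close> there is a continuous \<open>h\<close> into the unit interval that vanishes
  exactly on \<open>F\<close> and, off \<open>F\<close>, is rational exactly on \<open>E\<close>: in a Urysohn construction indexed by
  rationals, take the level sets to be partitions inside \<open>E\<close>, and let the \<open>n\<close>-th level absorb
  whatever part of \<open>L 0, \<dots>, L n\<close> lies between its two neighbouring levels (a compact set, as
  the earlier levels are clopen in each \<open>L i\<close>). As \<open>E\<close> does not depend on \<open>F\<close>, any sequence of such
  functions maps \<open>X\<close> into the target; the closed sets \<open>F\<close> are the pieces of \<open>A\<close> for the coordinates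
  \<open>2 ^ k * 3 ^ l\<close> and the closures of the members of a countable base for the odd coordinates, which
  separate points.
\<close>

section \<open>Zero-dimensional partitions\<close>

text \<open>For closed subsets of normal spaces, this is large inductive dimension at most \<open>0\<close>.\<close>
definition splittable_in :: "'a topology \<Rightarrow> 'a set \<Rightarrow> bool" where
  "splittable_in X L \<longleftrightarrow> closedin X L \<and>
     (\<forall>C D. closedin X C \<and> closedin X D \<and> C \<inter> D = {} \<longrightarrow>
       (\<exists>K K'. closedin X K \<and> closedin X K' \<and> K \<inter> K' = {} \<and> K \<union> K' = L \<and>
          C \<inter> K' = {} \<and> D \<inter> K = {}))"

lemma splittable_inD:
  assumes "splittable_in X L" "closedin X C" "closedin X D" "C \<inter> D = {}"
  obtains K K' where "closedin X K" "closedin X K'" "K \<inter> K' = {}" "K \<union> K' = L"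
    "C \<inter> K' = {}" "D \<inter> K = {}"
proof -
  have "\<exists>K K'. closedin X K \<and> closedin X K' \<and> K \<inter> K' = {} \<and> K \<union> K' = L \<and>
          C \<inter> K' = {} \<and> D \<inter> K = {}"
    using assms by (simp add: splittable_in_def)
  then show thesis
    by (elim exE conjE) (rule that)
qed

lemma splittable_in_empty: "splittable_in X {}"
  unfolding splittable_in_def
  by (intro conjI allI impI closedin_empty, rule exI[of _ "{}"], rule exI[of _ "{}"]) simp

text \<open>Split both sets separately and unite corresponding pieces; disjointness of
  \<open>L\<close> and \<open>M\<close> keeps a piece of one off the opposite piece of the
  other.\<close>

lemma splittable_in_Un:
  assumes L: "splittable_in X L" and M: "splittable_in X M" and "L \<inter> M = {}"
  shows "splittable_in X (L \<union> M)"
  unfolding splittable_in_def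
proof (intro conjI allI impI)
  show "closedin X (L \<union> M)"
    using L M by (auto simp: splittable_in_def)
  fix C D assume CD: "closedin X C \<and> closedin X D \<and> C \<inter> D = {}"
  obtain K K' where K: "closedin X K" "closedin X K'" "K \<inter> K' = {}" "K \<union> K' = L"
    "C \<inter> K' = {}" "D \<inter> K = {}"
    using splittable_inD[OF L] CD by metis
  obtain J J' where J: "closedin X J" "closedin X J'" "J \<inter> J' = {}" "J \<union> J' = M"
    "C \<inter> J' = {}" "D \<inter> J = {}"
    using splittable_inD[OF M] CD by metis
  have "(K \<union> J) \<inter> (K' \<union> J') = {}" "K \<union> J \<union> (K' \<union> J') = L \<union> M"
    "C \<inter> (K' \<union> J') = {}" "D \<inter> (K \<union> J) = {}"
    using K J assms(3) by blast+
  then show "\<exists>K K'. closedin X K \<and> closedin X K' \<and> K \<inter> K' = {} \<and> K \<union> K' = L \<union> M \<and>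
          C \<inter> K' = {} \<and> D \<inter> K = {}"
    using K J by - (rule exI[of _ "K \<union> J"], rule exI[of _ "K' \<union> J'"], simp add: closedin_Un)
qed

lemma splittable_in_UN:
  assumes "finite I" "\<And>i. i \<in> I \<Longrightarrow> splittable_in X (L i)" "disjoint_family_on L I"
  shows "splittable_in X (\<Union>i\<in>I. L i)"
  using assms
proof (induction I)
  case empty
  then show ?case by (simp add: splittable_in_empty)
next
  case (insert i I)
  have "L i \<inter> (\<Union>j\<in>I. L j) = {}"
    using insert.prems(2) insert.hyps(2) by (force simp: disjoint_family_on_def)
  moreover have "splittable_in X (\<Union>j\<in>I. L j)"
    using insert by (auto simp: disjoint_family_on_def)
  ultimately show ?case
    using insert.prems(1) splittable_in_Un by (metis UN_insert insertI1)
qed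

text \<open>
  Because no three members of the refinement meet, the overlap of the members meeting \<open>P\<close> with the
  remaining ones is a disjoint union of pairwise intersections.
\<close>
lemma covering_dim_le_1_overlap:
  assumes dim: "covering_dim_le X 1"
    and cl: "closedin X P" "closedin X Q" "closedin X C" "closedin X D"
    and dj: "P \<inter> Q = {}" "C \<inter> D = {}"
  obtains A B G G' where "openin X A" "openin X B" "openin X G" "openin X G'"
    "A \<union> B = topspace X" "Q \<inter> A = {}" "P \<inter> B = {}"
    "A \<inter> B = G \<union> G'" "G \<inter> G' = {}" "D \<inter> G = {}" "C \<inter> G' = {}"
proof -
  define T where "T = topspace X"
  \<comment> \<open>No point lies in both \<open>P\<close> and \<open>Q\<close> or in both
    \<open>C\<close> and \<open>D\<close>, so these four sets cover the space; a member of a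
    refinement misses one of \<open>P\<close>, \<open>Q\<close> and one of \<open>C\<close>,
    \<open>D\<close>.\<close>
  define \<U> where "\<U> = {T - P - C, T - P - D, T - Q - C, T - Q - D}"
  have "finite \<U>" "\<Union>\<U> = topspace X"
    using dj by (auto simp: \<U>_def T_def)
  moreover have "\<forall>U\<in>\<U>. openin X U"
    using cl by (auto simp: \<U>_def T_def intro!: openin_diff)
  ultimately obtain \<V> where \<V>: "finite \<V>" "\<forall>V\<in>\<V>. openin X V" "\<Union>\<V> = topspace X"
      "\<forall>V\<in>\<V>. \<exists>U\<in>\<U>. V \<subseteq> U"
      "\<forall>\<F>. \<F> \<subseteq> \<V> \<and> int (card \<F>) > 2 \<longrightarrow> \<Inter>\<F> = {}"
    using dim unfolding covering_dim_le_def by (metis one_add_one)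
  have three: "U \<inter> V \<inter> W = {}" if "U \<in> \<V>" "V \<in> \<V>" "W \<in> \<V>" "U \<noteq> V" "U \<noteq> W" "V \<noteq> W" for U V W
  proof -
    have "\<Inter>{U, V, W} = {}"
      using that by (intro \<V>(5)[rule_format]) auto
    then show ?thesis by auto
  qed
  have ref: "(V \<inter> P = {} \<or> V \<inter> Q = {}) \<and> (V \<inter> C = {} \<or> V \<inter> D = {})" if "V \<in> \<V>" for V
    using \<V>(4) that by (fastforce simp: \<U>_def)
  define \<A> where "\<A> = {V \<in> \<V>. V \<inter> P \<noteq> {}}"
  define \<B> where "\<B> = {V \<in> \<V>. V \<inter> P = {}}"
  \<comment> \<open>Pairs whose intersection meets \<open>D\<close> go to \<open>G'\<close>; their
    members meet \<open>D\<close>, hence miss \<open>C\<close>.\<close>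
  define G where "G = (\<Union>V\<in>\<A>. \<Union>W\<in>{W \<in> \<B>. V \<inter> W \<inter> D = {}}. V \<inter> W)"
  define G' where "G' = (\<Union>V\<in>\<A>. \<Union>W\<in>{W \<in> \<B>. V \<inter> W \<inter> D \<noteq> {}}. V \<inter> W)"
  show ?thesis
  proof
    show "openin X (\<Union>\<A>)" "openin X (\<Union>\<B>)"
      using \<V>(2) by (auto simp: \<A>_def \<B>_def)
    show "openin X G" "openin X G'"
      unfolding G_def G'_def \<A>_def \<B>_def using \<V>(2)
      by (intro openin_Union; force)+
    show "\<Union>\<A> \<union> \<Union>\<B> = topspace X"
      unfolding \<V>(3)[symmetric] \<A>_def \<B>_def by blast
    show "Q \<inter> \<Union>\<A> = {}" "P \<inter> \<Union>\<B> = {}"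
      using ref by (auto simp: \<A>_def \<B>_def)
    have "V \<inter> W \<subseteq> G \<union> G'" if "V \<in> \<A>" "W \<in> \<B>" for V W
      using that by (cases "V \<inter> W \<inter> D = {}") (auto simp: G_def G'_def)
    then have "\<Union>\<A> \<inter> \<Union>\<B> \<subseteq> G \<union> G'"
      by auto
    moreover have "G \<union> G' \<subseteq> \<Union>\<A> \<inter> \<Union>\<B>"
      unfolding G_def G'_def by blast
    ultimately show "\<Union>\<A> \<inter> \<Union>\<B> = G \<union> G'"
      by (rule equalityI)
    show "G \<inter> G' = {}"
    proof (rule ccontr)
      assume "G \<inter> G' \<noteq> {}"
      then obtain x where "x \<in> G" "x \<in> G'" by blast
      obtain V W where V: "V \<in> \<A>" "W \<in> \<B>" "x \<in> V" "x \<in> W" "V \<inter> W \<inter> D = {}"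
        using \<open>x \<in> G\<close> unfolding G_def by blast
      obtain V' W' where V': "V' \<in> \<A>" "W' \<in> \<B>" "x \<in> V'" "x \<in> W'" "V' \<inter> W' \<inter> D \<noteq> {}"
        using \<open>x \<in> G'\<close> unfolding G'_def by blast
      have "V = V'"
        using three[of V V' W] V V' by (auto simp: \<A>_def \<B>_def)
      moreover have "W = W'"
        using three[of V W W'] V V' by (auto simp: \<A>_def \<B>_def)
      ultimately show False
        using V(5) V'(5) by simp
    qed
    show "D \<inter> G = {}"
      by (auto simp: G_def)
    show "C \<inter> G' = {}"
      using ref by (force simp: G'_def \<A>_def)
  qed
qed

section \<open>Compact Hausdorff spaces with a countable base\<close>

locale compact_with_base =
  fixes X :: "'a topology" and B :: "nat \<Rightarrow> 'a set"
  assumes compact: "compact_space X"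
    and Hausdorff: "Hausdorff_space X"
    and open_base: "openin X (B n)"
    and base: "openin X U \<Longrightarrow> x \<in> U \<Longrightarrow> \<exists>n. x \<in> B n \<and> X closure_of B n \<subseteq> U"
begin

lemma normal: "normal_space X"
  using compact Hausdorff compact_Hausdorff_or_regular_imp_normal_space by blast

lemma closedin_imp_compactin: "closedin X C \<Longrightarrow> compactin X C"
  using compact closedin_compact_space by blast

lemma base_subset_closure: "B n \<subseteq> X closure_of B n"
  by (simp add: closure_of_subset open_base openin_subset)

lemma finite_base_cover:
  assumes "closedin X C" "openin X U" "C \<subseteq> U"
  obtains I where "finite I" "C \<subseteq> (\<Union>i\<in>I. B i)" "(\<Union>i\<in>I. X closure_of B i) \<subseteq> U"
proof -
  have "C \<subseteq> \<Union> (B ` {n. X closure_of B n \<subseteq> U})"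
    using base[OF assms(2)] assms(3) by blast
  then obtain \<F> where \<F>: "finite \<F>" "\<F> \<subseteq> B ` {n. X closure_of B n \<subseteq> U}" "C \<subseteq> \<Union>\<F>"
    using compactinD[OF closedin_imp_compactin[OF assms(1)], of "B ` {n. X closure_of B n \<subseteq> U}"]
      open_base by blast
  obtain I where "I \<subseteq> {n. X closure_of B n \<subseteq> U}" "finite I" "\<F> = B ` I"
    using finite_subset_image[OF \<F>(1,2)] by blast
  with \<F>(3) show ?thesis
    by (intro that) auto
qed

lemma separate_closed:
  assumes "closedin X C" "closedin X D" "C \<inter> D = {}"
  obtains U V where "openin X U" "openin X V" "C \<subseteq> U" "D \<subseteq> V"
    "X closure_of U \<inter> X closure_of V = {}"
proof -
  have sub: "C \<subseteq> topspace X - D"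
    using assms closedin_subset by fastforce
  obtain U where U: "openin X U" "C \<subseteq> U" "X closure_of U \<subseteq> topspace X - D"
    using normal sub assms(1,2) unfolding normal_space_alt by (metis openin_diff openin_topspace)
  have "D \<subseteq> topspace X - X closure_of U"
    using U(3) assms(2) closedin_subset by fastforce
  then obtain V where V: "openin X V" "D \<subseteq> V" "X closure_of V \<subseteq> topspace X - X closure_of U"
    using normal assms(2) unfolding normal_space_alt by (metis closedin_closure_of openin_diff openin_topspace)
  have "X closure_of U \<inter> X closure_of V = {}"
    using V(3) by blast
  with that[OF U(1) V(1) U(2) V(2)] show ?thesis .
qed

text \<open>Compactness squeezes a finite union of closures of base members between a closed set and
  any open neighbourhood of it, and there are only countably many such unions. A condition on
  disjoint closed pairs that passes to smaller pairs can thus be met along one sequence.\<close>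

lemma ex_closed_pair_enumeration:
  "\<exists>P Q :: nat \<Rightarrow> 'a set. (\<forall>n. closedin X (P n) \<and> closedin X (Q n) \<and> P n \<inter> Q n = {}) \<and>
     (\<forall>C D. closedin X C \<and> closedin X D \<and> C \<inter> D = {} \<longrightarrow> (\<exists>n. C \<subseteq> P n \<and> D \<subseteq> Q n))"
proof -
  define K where "K m = (\<Union>i\<in>set (from_nat m). X closure_of B i)" for m
  \<comment> \<open>The value \<open>({}, {})\<close> replaces pairs that meet, so that every term
    is a disjoint pair.\<close>
  define J where "J n = (if K (fst (prod_decode n)) \<inter> K (snd (prod_decode n)) = {}
      then (K (fst (prod_decode n)), K (snd (prod_decode n))) else ({}, {}))" for n
  have K: "closedin X (K m)" for m
    unfolding K_def by (intro closedin_Union) auto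
  have ex: "\<exists>m. C \<subseteq> K m \<and> K m \<subseteq> U" if CU: "closedin X C" "openin X U" "C \<subseteq> U" for C U
  proof -
    obtain I where I: "finite I" "C \<subseteq> (\<Union>i\<in>I. B i)" "(\<Union>i\<in>I. X closure_of B i) \<subseteq> U"
      using finite_base_cover[OF CU] .
    obtain xs where "set xs = I"
      using I(1) finite_list by blast
    then have "K (to_nat xs) = (\<Union>i\<in>I. X closure_of B i)"
      by (simp add: K_def)
    moreover have "(\<Union>i\<in>I. B i) \<subseteq> (\<Union>i\<in>I. X closure_of B i)"
      by (intro UN_mono base_subset_closure order_refl)
    ultimately show ?thesis
      using I by (metis order_trans)
  qed
  show ?thesis
  proof (rule exI[of _ "\<lambda>n. fst (J n)"], rule exI[of _ "\<lambda>n. snd (J n)"], intro conjI allI impI)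
    show "closedin X (fst (J n))" "closedin X (snd (J n))" "fst (J n) \<inter> snd (J n) = {}" for n
      using K by (auto simp: J_def)
    fix C D assume "closedin X C \<and> closedin X D \<and> C \<inter> D = {}"
    then have CD: "closedin X C" "closedin X D" "C \<inter> D = {}"
      by auto
    obtain U V where U: "openin X U" "openin X V" "C \<subseteq> U" "D \<subseteq> V"
      "X closure_of U \<inter> X closure_of V = {}"
      using separate_closed[OF CD] .
    obtain m k where m: "C \<subseteq> K m" "K m \<subseteq> U" "D \<subseteq> K k" "K k \<subseteq> V"
      using ex CD U by metis
    have "U \<inter> V = {}"
      using U closure_of_subset[of U X] closure_of_subset[of V X] openin_subset by blast
    then have "J (prod_encode (m, k)) = (K m, K k)"
      using m by (auto simp: J_def)
    then show "\<exists>n. C \<subseteq> fst (J n) \<and> D \<subseteq> snd (J n)"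
      using m by (intro exI[of _ "prod_encode (m, k)"]) simp
  qed
qed

text \<open>Two disjoint open sets grow from \<open>C\<close> and \<open>D\<close>. At stage
  \<open>n\<close> the rest of the space is pushed into disjoint open sets \<open>G\<close>,
  \<open>G'\<close> that split the pair \<open>P n\<close>, \<open>Q n\<close>; what remains in the
  limit is split by all these pairs.\<close>

lemma ex_splittable_partition:
  assumes dim: "covering_dim_le X 1"
    and C: "closedin X C" and D: "closedin X D" and CD: "C \<inter> D = {}"
  obtains U V where "openin X U" "openin X V" "C \<subseteq> U" "D \<subseteq> V" "U \<inter> V = {}"
    "splittable_in X (topspace X - (U \<union> V))"
proof -
  obtain P Q :: "nat \<Rightarrow> 'a set" where PQ':
    "\<forall>n. closedin X (P n) \<and> closedin X (Q n) \<and> P n \<inter> Q n = {}"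
    and cofinal: "\<forall>C D. closedin X C \<and> closedin X D \<and> C \<inter> D = {} \<longrightarrow> (\<exists>n. C \<subseteq> P n \<and> D \<subseteq> Q n)"
    using ex_closed_pair_enumeration by blast
  have PQ: "closedin X (P n)" "closedin X (Q n)" "P n \<inter> Q n = {}" for n
    using PQ' by blast+
  \<comment> \<open>The closures are kept disjoint because the next stage applies
    \<open>covering_dim_le_1_overlap\<close> to them.\<close>
  define good where "good n z \<longleftrightarrow> openin X (fst z) \<and> openin X (snd z) \<and>
     X closure_of (fst z) \<inter> X closure_of (snd z) = {} \<and> C \<subseteq> fst z \<and> D \<subseteq> snd z"
    for n :: nat and z :: "'a set \<times> 'a set"
  define step where "step n z z' \<longleftrightarrow> fst z \<subseteq> fst z' \<and> snd z \<subseteq> snd z' \<and>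
     (\<exists>G G'. openin X G \<and> openin X G' \<and> topspace X - (fst z' \<union> snd z') \<subseteq> G \<union> G' \<and>
        G \<inter> G' = {} \<and> Q n \<inter> G = {} \<and> P n \<inter> G' = {})"
    for n and z z' :: "'a set \<times> 'a set"
  have "\<exists>f. \<forall>n. good n (f n) \<and> step n (f n) (f (Suc n))"
  proof (rule dependent_nat_choice)
    obtain U V where "openin X U" "openin X V" "C \<subseteq> U" "D \<subseteq> V"
      "X closure_of U \<inter> X closure_of V = {}"
      using separate_closed[OF C D CD] .
    then have "good 0 (U, V)"
      by (simp add: good_def)
    then show "\<exists>z. good 0 z" ..
  next
    fix z n assume z: "good n z"
    obtain A B G G' where A: "openin X A" "openin X B" and G: "openin X G" "openin X G'"
      and AB: "A \<union> B = topspace X" "X closure_of (snd z) \<inter> A = {}" "X closure_of (fst z) \<inter> B = {}"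
      and AG: "A \<inter> B = G \<union> G'" "G \<inter> G' = {}" "Q n \<inter> G = {}" "P n \<inter> G' = {}"
      by (rule covering_dim_le_1_overlap[OF dim, of "X closure_of (fst z)" "X closure_of (snd z)" "P n" "Q n"])
        (use z PQ in \<open>auto simp: good_def\<close>)
    \<comment> \<open>The complements of \<open>B\<close> and \<open>A\<close> are disjoint closed
      sets containing the old pair; outside any neighbourhoods of them only points of
      \<open>A \<inter> B = G \<union> G'\<close> are left.\<close>
    have dj: "(topspace X - B) \<inter> (topspace X - A) = {}"
      using AB(1) by blast
    obtain U V where U: "openin X U" "openin X V" "topspace X - B \<subseteq> U" "topspace X - A \<subseteq> V"
      "X closure_of U \<inter> X closure_of V = {}"
      by (rule separate_closed[of "topspace X - B" "topspace X - A"]) (use A dj in auto)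
    have zs: "fst z \<subseteq> topspace X" "snd z \<subseteq> topspace X"
      "fst z \<subseteq> X closure_of fst z" "snd z \<subseteq> X closure_of snd z"
      using z by (auto simp: good_def openin_subset closure_of_subset)
    have "fst z \<subseteq> topspace X - B"
      using AB(3) zs(1,3) by blast
    moreover have "snd z \<subseteq> topspace X - A"
      using AB(2) zs(2,4) by blast
    ultimately have sub: "fst z \<subseteq> U" "snd z \<subseteq> V"
      using U(3,4) by (meson order_trans)+
    have "topspace X - (U \<union> V) \<subseteq> G \<union> G'"
      using U(3,4) AG(1) by blast
    then have "step n z (U, V)"
      using sub G AG(2-4) unfolding step_def fst_conv snd_conv by blast
    moreover have "good (Suc n) (U, V)"
      using U(1,2,5) sub z unfolding good_def fst_conv snd_conv by blast
    ultimately have "good (Suc n) (U, V) \<and> step n z (U, V)"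
      by blast
    then show "\<exists>z'. good (Suc n) z' \<and> step n z z'" ..
  qed
  then obtain f where f: "\<And>n. good n (f n)" "\<And>n. step n (f n) (f (Suc n))"
    by blast
  define U where "U = (\<Union>n. fst (f n))"
  define V where "V = (\<Union>n. snd (f n))"
  have mono: "fst (f m) \<subseteq> fst (f n)" "snd (f m) \<subseteq> snd (f n)" if "m \<le> n" for m n
    using that f(2) lift_Suc_mono_le[of "\<lambda>n. fst (f n)"] lift_Suc_mono_le[of "\<lambda>n. snd (f n)"]
    by (simp_all add: step_def)
  have dj: "fst (f n) \<inter> snd (f n) = {}" for n
    using f(1)[of n] closure_of_subset[of "fst (f n)" X] closure_of_subset[of "snd (f n)" X] openin_subset
    unfolding good_def by blast
  have opUV: "openin X U" "openin X V"
    using f(1) by (auto simp: U_def V_def good_def)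
  show ?thesis
  proof
    show "openin X U" "openin X V" by fact+
    show "C \<subseteq> U" "D \<subseteq> V"
      using f(1)[of 0] by (auto simp: U_def V_def good_def)
    show "U \<inter> V = {}"
    proof -
      have "x \<notin> snd (f n)" if "x \<in> fst (f m)" for x m n
        using that mono[of m "max m n"] mono[of n "max m n"] dj[of "max m n"] by auto
      then show ?thesis by (auto simp: U_def V_def)
    qed
    define L where "L = topspace X - (U \<union> V)"
    have L: "closedin X L"
      using opUV by (auto simp: L_def)
    show "splittable_in X (topspace X - (U \<union> V))"
      unfolding L_def[symmetric] splittable_in_def
    proof (intro conjI allI impI L)
      fix C' D' assume "closedin X C' \<and> closedin X D' \<and> C' \<inter> D' = {}"
      then obtain n where n: "C' \<subseteq> P n" "D' \<subseteq> Q n"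
        using cofinal[rule_format, of C' D'] by auto
      obtain G G' where G: "openin X G" "openin X G'" 
        "topspace X - (fst (f (Suc n)) \<union> snd (f (Suc n))) \<subseteq> G \<union> G'"
        "G \<inter> G' = {}" "Q n \<inter> G = {}" "P n \<inter> G' = {}"
        using f(2)[of n] unfolding step_def by blast
      \<comment> \<open>As \<open>L\<close> lies in the union of the disjoint open sets
        \<open>G\<close> and \<open>G'\<close>, removing either one leaves a closed piece inside the
        other.\<close>
      have "L \<subseteq> G \<union> G'"
        using G(3) by (auto simp: L_def U_def V_def)
      moreover have "closedin X (L - G')" "closedin X (L - G)"
        using L G by auto
      ultimately show "\<exists>K K'. closedin X K \<and> closedin X K' \<and> K \<inter> K' = {} \<and> K \<union> K' = L \<and>
          C' \<inter> K' = {} \<and> D' \<inter> K = {}"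
        using G(4-6) n by - (rule exI[of _ "L - G'"], rule exI[of _ "L - G"], blast)
    qed
  qed
qed

end

section \<open>Pairwise disjoint partitions\<close>

text \<open>For closed \<open>L j\<close> this says that the trace of \<open>S\<close> on each of
  them is clopen in it. Such sets form a Boolean algebra, which is what keeps the pieces absorbed
  later closed.\<close>

definition adapted_to :: "'a topology \<Rightarrow> (nat \<Rightarrow> 'a set) \<Rightarrow> 'a set \<Rightarrow> bool" where
  "adapted_to X L S \<longleftrightarrow> (\<forall>j. closedin X (S \<inter> L j) \<and> closedin X (L j - S))"

lemma adapted_to_Un:
  assumes "adapted_to X L S" "adapted_to X L T"
  shows "adapted_to X L (S \<union> T)"
proof -
  have "(S \<union> T) \<inter> L j = S \<inter> L j \<union> T \<inter> L j" "L j - (S \<union> T) = (L j - S) \<inter> (L j - T)" for j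
    by auto
  then show ?thesis
    using assms by (simp add: adapted_to_def closedin_Un closedin_Int)
qed

lemma adapted_to_Int:
  assumes "adapted_to X L S" "adapted_to X L T"
  shows "adapted_to X L (S \<inter> T)"
proof -
  have "(S \<inter> T) \<inter> L j = (S \<inter> L j) \<inter> (T \<inter> L j)" "L j - (S \<inter> T) = (L j - S) \<union> (L j - T)" for j
    by auto
  then show ?thesis
    using assms by (simp add: adapted_to_def closedin_Un closedin_Int)
qed

lemma adapted_to_Diff:
  assumes "adapted_to X L S" "adapted_to X L T"
  shows "adapted_to X L (S - T)"
proof -
  have "(S - T) \<inter> L j = (S \<inter> L j) \<inter> (L j - T)" "L j - (S - T) = (L j - S) \<union> (T \<inter> L j)" for j
    by auto
  then show ?thesis
    using assms by (simp add: adapted_to_def closedin_Un closedin_Int)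
qed

lemma adapted_to_empty: "(\<And>j. closedin X (L j)) \<Longrightarrow> adapted_to X L {}"
  by (simp add: adapted_to_def)

lemma adapted_to_topspace:
  assumes "\<And>j. closedin X (L j)"
  shows "adapted_to X L (topspace X)"
proof -
  have *: "topspace X \<inter> L j = L j" "L j - topspace X = {}" for j
    using closedin_subset[OF assms[of j]] by auto
  show ?thesis
    using assms unfolding adapted_to_def * by simp
qed

lemma adapted_to_UN:
  assumes "\<And>j. closedin X (L j)" "finite I" "\<And>i. i \<in> I \<Longrightarrow> adapted_to X L (S i)"
  shows "adapted_to X L (\<Union>i\<in>I. S i)"
  using assms(2,3) by (induction I) (auto simp: adapted_to_empty assms(1) intro: adapted_to_Un)

lemma adapted_to_INT:
  assumes "\<And>j. closedin X (L j)" "finite I" "\<And>i. i \<in> I \<Longrightarrow> adapted_to X L (S i)"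
  shows "adapted_to X L (topspace X \<inter> (\<Inter>i\<in>I. S i))"
  using assms(2,3)
proof (induction I)
  case empty
  then show ?case by (simp add: adapted_to_topspace assms(1))
next
  case (insert i I)
  have "topspace X \<inter> (\<Inter>j\<in>insert i I. S j) = S i \<inter> (topspace X \<inter> (\<Inter>j\<in>I. S j))"
    by auto
  then show ?case
    using insert by (simp add: adapted_to_Int)
qed

lemma adapted_to_member:
  assumes "\<And>j. closedin X (L j)" "disjoint_family L"
  shows "adapted_to X L (L i)"
proof -
  have *: "L i \<inter> L j = (if i = j then L j else {})" "L j - L i = (if i = j then {} else L j)" for j
    using assms(2) by (auto simp: disjoint_family_on_def)
  show ?thesis
    using assms(1) unfolding adapted_to_def * by simp
qed

text \<open>\<open>U\<close> and \<open>D\<close> stand for the strict and the weak sublevel set at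
  one value, so \<open>D - U\<close> is a level set. It has to lie in the union of the
  \<open>L i\<close>, a set fixed before \<open>C\<close> and \<open>G\<close>.\<close>

locale partitioned_compact_space = compact_with_base X B for X :: "'a topology" and B +
  fixes L :: "nat \<Rightarrow> 'a set"
  assumes closedin_L: "closedin X (L i)"
    and disjoint_L: "disjoint_family L"
    and ex_adapted_partition: "\<lbrakk>closedin X C; openin X G; C \<subseteq> G\<rbrakk> \<Longrightarrow>
      \<exists>U D. openin X U \<and> closedin X D \<and> C \<subseteq> U \<and> U \<subseteq> D \<and> D \<subseteq> G \<and> D - U \<subseteq> (\<Union>i. L i) \<and>
        adapted_to X L U \<and> adapted_to X L D"

section \<open>Construction of a disjoint family of partitions\<close>

context compact_with_base
begin

text \<open>Split \<open>Z\<close> between \<open>C\<close> and \<open>D\<close>, add each piece to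
  its side and separate the enlarged sets: the resulting partition cannot touch
  \<open>Z\<close>.\<close>

lemma ex_splittable_partition_avoiding:
  assumes dim: "covering_dim_le X 1"
    and C: "closedin X C" and D: "closedin X D" and CD: "C \<inter> D = {}" and Z: "splittable_in X Z"
  obtains U V where "openin X U" "openin X V" "C \<subseteq> U" "D \<subseteq> V" "U \<inter> V = {}"
    "splittable_in X (topspace X - (U \<union> V))" "Z \<inter> (topspace X - (U \<union> V)) = {}"
proof -
  obtain K K' where K: "closedin X K" "closedin X K'" "K \<inter> K' = {}" "K \<union> K' = Z"
    "C \<inter> K' = {}" "D \<inter> K = {}"
    by (rule splittable_inD[OF Z C D CD])
  have "closedin X (C \<union> K)" "closedin X (D \<union> K')"
    using C D K(1,2) closedin_Un by auto
  moreover have "(C \<union> K) \<inter> (D \<union> K') = {}"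
    using K(3,5,6) CD by blast
  ultimately obtain U V where "openin X U" "openin X V" "C \<union> K \<subseteq> U" "D \<union> K' \<subseteq> V" "U \<inter> V = {}"
    "splittable_in X (topspace X - (U \<union> V))"
    by (rule ex_splittable_partition[OF dim])
  with K(4) show thesis
    by (intro that[of U V]) auto
qed

text \<open>The earlier partitions are finitely many and pairwise disjoint, so their union is
  splittable and the next one can avoid it.\<close>

lemma ex_disjoint_partitions:
  fixes P Q :: "nat \<Rightarrow> 'a set"
  assumes dim: "covering_dim_le X 1"
    and PQ: "\<And>n. closedin X (P n)" "\<And>n. closedin X (Q n)" "\<And>n. P n \<inter> Q n = {}"
  shows "\<exists>U V :: nat \<Rightarrow> 'a set. (\<forall>n. openin X (U n) \<and> openin X (V n) \<and> P n \<subseteq> U n \<and> Q n \<subseteq> V n \<and>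
      U n \<inter> V n = {}) \<and> disjoint_family (\<lambda>n. topspace X - (U n \<union> V n))"
proof -
  define L where "L z = topspace X - (fst z \<union> snd z)" for z :: "'a set \<times> 'a set"
  define good where "good f n z \<longleftrightarrow> openin X (fst z) \<and> openin X (snd z) \<and> P n \<subseteq> fst z \<and> Q n \<subseteq> snd z \<and>
      fst z \<inter> snd z = {} \<and> splittable_in X (L z) \<and> (\<forall>i<n. L (f i) \<inter> L z = {})"
    for f :: "nat \<Rightarrow> 'a set \<times> 'a set" and n z
  have "\<exists>f. \<forall>n. good f n (f n)"
  proof (rule dependent_wf_choice[OF wf])
    fix f g :: "nat \<Rightarrow> 'a set \<times> 'a set" and n z
    assume "\<And>i. (i, n) \<in> {(x, y). x < y} \<Longrightarrow> f i = g i"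
    then show "good f n z = good g n z"
      by (simp add: good_def)
  next
    fix n f assume IH: "\<And>i. (i, n) \<in> {(x, y). x < y} \<Longrightarrow> good f i (f i)"
    have "L (f i) \<inter> L (f j) = {}" if "i < j" "j < n" for i j
      using IH[of j] that by (simp add: good_def)
    then have "disjoint_family_on (\<lambda>i. L (f i)) {..<n}"
      unfolding disjoint_family_on_def by (metis Int_commute lessThan_iff linorder_neqE_nat)
    then have "splittable_in X (\<Union>i\<in>{..<n}. L (f i))"
      using IH by (intro splittable_in_UN) (auto simp: good_def)
    from ex_splittable_partition_avoiding[OF dim PQ(1,2,3)[of n] this]
    obtain U V where "openin X U" "openin X V" "P n \<subseteq> U" "Q n \<subseteq> V" "U \<inter> V = {}"
      "splittable_in X (topspace X - (U \<union> V))"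
      "(\<Union>i\<in>{..<n}. L (f i)) \<inter> (topspace X - (U \<union> V)) = {}" .
    then have "good f n (U, V)"
      by (auto simp: good_def L_def)
    then show "\<exists>z. good f n z" ..
  qed
  then obtain f where f: "\<And>n. good f n (f n)"
    by blast
  show ?thesis
  proof (rule exI[of _ "\<lambda>n. fst (f n)"], rule exI[of _ "\<lambda>n. snd (f n)"], rule conjI)
    have "L (f i) \<inter> L (f j) = {}" if "i < j" for i j
      using f[of j] that by (simp add: good_def)
    then have "L (f i) \<inter> L (f j) = {}" if "i \<noteq> j" for i j
      using that by (metis Int_commute linorder_neqE_nat)
    then show "disjoint_family (\<lambda>n. topspace X - (fst (f n) \<union> snd (f n)))"
      by (simp add: disjoint_family_on_def L_def)
  qed (use f in \<open>simp add: good_def\<close>)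
qed

text \<open>A member \<open>L j\<close> other than \<open>L n\<close> misses \<open>L n\<close>, so
  the disjoint open sets \<open>U n\<close> and \<open>V n\<close> cover it and cut it into clopen
  pieces; \<open>L n\<close> itself misses both. Hence all \<open>U n\<close> and \<open>V n\<close>
  are adapted.\<close>

lemma ex_partitioned_compact_space:
  assumes dim: "covering_dim_le X 1"
  obtains L where "partitioned_compact_space X B L"
proof -
  obtain P Q :: "nat \<Rightarrow> 'a set" where
    PQ': "\<forall>n. closedin X (P n) \<and> closedin X (Q n) \<and> P n \<inter> Q n = {}"
    and cofinal: "\<forall>C D. closedin X C \<and> closedin X D \<and> C \<inter> D = {} \<longrightarrow> (\<exists>n. C \<subseteq> P n \<and> D \<subseteq> Q n)"
    using ex_closed_pair_enumeration by blast
  have PQ: "closedin X (P n)" "closedin X (Q n)" "P n \<inter> Q n = {}" for n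
    using PQ' by blast+
  obtain U V :: "nat \<Rightarrow> 'a set" where UV': "\<forall>n. openin X (U n) \<and> openin X (V n) \<and> P n \<subseteq> U n \<and>
      Q n \<subseteq> V n \<and> U n \<inter> V n = {}"
    and dj: "disjoint_family (\<lambda>n. topspace X - (U n \<union> V n))"
    using ex_disjoint_partitions[of P Q, OF dim PQ] by blast
  have UV: "openin X (U n)" "openin X (V n)" "P n \<subseteq> U n" "Q n \<subseteq> V n" "U n \<inter> V n = {}" for n
    using UV' by blast+
  define L where "L n = topspace X - (U n \<union> V n)" for n
  have closedin_L: "closedin X (L n)" for n
    using UV(1,2) by (auto simp: L_def)
  have meet: "U n \<inter> L j = (if j = n then {} else L j - V n)"
    "V n \<inter> L j = (if j = n then {} else L j - U n)" for j n
  proof -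
    have "L j \<subseteq> U n \<union> V n" if "j \<noteq> n"
      using dj that by (auto simp: disjoint_family_on_def L_def)
    then show "U n \<inter> L j = (if j = n then {} else L j - V n)"
      "V n \<inter> L j = (if j = n then {} else L j - U n)"
      using UV(5)[of n] by (auto simp: L_def)
  qed
  have adapted: "adapted_to X L (U n)" "adapted_to X L (V n)" for n
    unfolding adapted_to_def meet using UV(1,2) closedin_L by auto
  have "partitioned_compact_space X B L"
  proof unfold_locales
    show "closedin X (L n)" for n by fact
    show "disjoint_family L"
      using dj by (simp add: disjoint_family_on_def L_def)
    fix C G assume CG: "closedin X C" "openin X G" "C \<subseteq> G"
    have "C \<inter> (topspace X - G) = {}" "closedin X (topspace X - G)"
      using CG by auto
    then obtain n where n: "C \<subseteq> P n" "topspace X - G \<subseteq> Q n"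
      using cofinal CG(1) by blast
    show "\<exists>U D. openin X U \<and> closedin X D \<and> C \<subseteq> U \<and> U \<subseteq> D \<and> D \<subseteq> G \<and> D - U \<subseteq> (\<Union>i. L i) \<and>
        adapted_to X L U \<and> adapted_to X L D"
    proof (rule exI[of _ "U n"], rule exI[of _ "topspace X - V n"], intro conjI)
      show "openin X (U n)" "closedin X (topspace X - V n)" "adapted_to X L (U n)"
        using UV adapted by auto
      show "adapted_to X L (topspace X - V n)"
        by (intro adapted_to_Diff adapted_to_topspace adapted closedin_L)
      show "C \<subseteq> U n"
        using n(1) UV(3)[of n] by (rule order_trans)
      show "U n \<subseteq> topspace X - V n"
        using UV(5)[of n] openin_subset[OF UV(1)[of n]] by blast
      show "topspace X - V n \<subseteq> G"
        using n(2) UV(4)[of n] by blast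
      show "topspace X - V n - U n \<subseteq> (\<Union>i. L i)"
        by (auto simp: L_def)
    qed
  qed
  then show thesis
    by (rule that)
qed

end

section \<open>Neighbours in an enumeration of a dense set\<close>

text \<open>
  At stage \<open>i\<close>, the upper neighbour of \<open>e i\<close> is older than its lower neighbour. The new level then hugs
  the upper neighbour, and otherwise the lower one. As the values closest to a fixed \<open>e n\<close> from below
  (above) eventually are (are not) of this kind, every level is approached from both sides.
\<close>
definition nested :: "(nat \<Rightarrow> real) \<Rightarrow> nat \<Rightarrow> bool" where
  "nested e i \<longleftrightarrow> (\<exists>n l. n < l \<and> l < i \<and> e l < e i \<and> e i < e n \<and>
     (\<forall>k<i. \<not> (e l < e k \<and> e k < e n)))"

text \<open>The index of a value is the stage at which its level is built. The neighbours of
  \<open>e i\<close> are the nearest values of smaller index on either side.\<close>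

locale dense_enumeration =
  fixes e :: "nat \<Rightarrow> real" and c :: real
  assumes inj: "inj e"
    and e_pos: "0 < e n"
    and e_less: "e n < c"
    and dense: "0 \<le> a \<Longrightarrow> a < b \<Longrightarrow> b \<le> c \<Longrightarrow> \<exists>n. a < e n \<and> e n < b"
begin

lemma c_pos: "0 < c"
  using e_pos[of 0] e_less[of 0] by simp

lemma ex_first_between:
  assumes "0 \<le> a" "a < b" "b \<le> c"
  obtains n where "a < e n" "e n < b" "\<And>k. k < n \<Longrightarrow> \<not> (a < e k \<and> e k < b)"
proof -
  let ?P = "\<lambda>n. a < e n \<and> e n < b"
  have "?P (LEAST n. ?P n)"
    using dense[OF assms] by (rule LeastI_ex)
  moreover have "\<not> ?P k" if "k < (LEAST n. ?P n)" for k
    using that by (rule not_less_Least)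
  ultimately show thesis
    using that by blast
qed

lemma ex_gap_below:
  assumes "0 < t"
  obtains a where "0 \<le> a" "a < t" "\<And>k. k < N \<Longrightarrow> \<not> (a < e k \<and> e k < t)"
proof -
  define S where "S = insert 0 (e ` {k. k < N \<and> e k < t})"
  have "finite S" "S \<noteq> {}" "\<And>s. s \<in> S \<Longrightarrow> s < t"
    using assms by (auto simp: S_def)
  moreover have "0 \<le> Max S"
    using \<open>finite S\<close> by (simp add: S_def)
  moreover have "e k \<le> Max S" if "k < N" "e k < t" for k
    using \<open>finite S\<close> that by (intro Max_ge) (auto simp: S_def)
  ultimately show thesis
    using that[of "Max S"] by (metis Max_in not_le)
qed

lemma ex_gap_above:
  assumes "t < c"
  obtains b where "b \<le> c" "t < b" "\<And>k. k < N \<Longrightarrow> \<not> (t < e k \<and> e k < b)"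
proof -
  define S where "S = insert c (e ` {k. k < N \<and> t < e k})"
  have "finite S" "S \<noteq> {}" "\<And>s. s \<in> S \<Longrightarrow> t < s"
    using assms by (auto simp: S_def)
  moreover have "Min S \<le> c"
    using \<open>finite S\<close> by (simp add: S_def)
  moreover have "Min S \<le> e k" if "k < N" "t < e k" for k
    using \<open>finite S\<close> that by (intro Min_le) (auto simp: S_def)
  ultimately show thesis
    using that[of "Min S"] by (metis Min_in not_le)
qed

text \<open>Values of index below \<open>N'\<close> leave a gap \<open>(a, e n)\<close>. The first
  value \<open>e l\<close> in this gap is younger than \<open>e n\<close>, and the first value
  \<open>e i\<close> in \<open>(e l, e n)\<close> has these two as neighbours, the upper one being
  older.\<close>

lemma ex_late_nested_below:
  obtains i where "N \<le> i" "n < i" "e i < e n" "\<And>k. k < i \<Longrightarrow> \<not> (e i < e k \<and> e k < e n)"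
    "nested e i"
proof -
  define N' where "N' = max N (Suc n)"
  obtain a where a: "0 \<le> a" "a < e n" "\<And>k. k < N' \<Longrightarrow> \<not> (a < e k \<and> e k < e n)"
    using ex_gap_below[OF e_pos] by metis
  obtain l where l: "a < e l" "e l < e n" "\<And>k. k < l \<Longrightarrow> \<not> (a < e k \<and> e k < e n)"
    using ex_first_between[OF a(1,2)] e_less[of n] by (metis less_imp_le)
  obtain i where i: "e l < e i" "e i < e n" "\<And>k. k < i \<Longrightarrow> \<not> (e l < e k \<and> e k < e n)"
    using ex_first_between[of "e l" "e n"] l(2) e_less[of n] e_pos[of l] by (metis less_imp_le)
  have "N' \<le> l"
    using a(3) l(1,2) by (meson not_le)
  moreover have "l < i"
    using l i by (metis linorder_neqE_nat less_irrefl order.strict_trans)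
  ultimately have "N \<le> i" "n < i" "n < l \<and> l < i \<and> e l < e i \<and> e i < e n"
    using i by (auto simp: N'_def)
  with i show thesis
    by (intro that[of i]) (auto simp: nested_def)
qed

text \<open>The same choice is made above \<open>e n\<close>: the neighbours of \<open>e i\<close>
  are \<open>e n\<close> and a younger \<open>e m\<close>, so now the older one is below.\<close>

lemma ex_late_not_nested_above:
  obtains i where "N \<le> i" "n < i" "e n < e i" "\<And>k. k < i \<Longrightarrow> \<not> (e n < e k \<and> e k < e i)"
    "\<not> nested e i"
proof -
  define N' where "N' = max N (Suc n)"
  obtain b where b: "b \<le> c" "e n < b" "\<And>k. k < N' \<Longrightarrow> \<not> (e n < e k \<and> e k < b)"
    using ex_gap_above[OF e_less] by metis
  obtain m where m: "e n < e m" "e m < b" "\<And>k. k < m \<Longrightarrow> \<not> (e n < e k \<and> e k < b)"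
    using ex_first_between[of "e n" b] b(1,2) e_pos[of n] by (metis less_imp_le)
  obtain i where i: "e n < e i" "e i < e m" "\<And>k. k < i \<Longrightarrow> \<not> (e n < e k \<and> e k < e m)"
    using ex_first_between[of "e n" "e m"] m(1) e_less[of m] e_pos[of n] by (metis less_imp_le)
  have m': "N' \<le> m"
    using b(3) m(1,2) by (meson not_le)
  moreover have mi: "m < i"
    using m i by (metis linorder_neqE_nat less_irrefl order.strict_trans)
  \<comment> \<open>Witnesses of \<open>nested\<close> would have the values of the two neighbours;
    injectivity of \<open>e\<close> makes their indices \<open>n\<close> and \<open>m\<close>, whose
    order is the wrong one.\<close>
  moreover have "\<not> nested e i"
  proof
    assume "nested e i"
    then obtain n' l' where n': "n' < l'" "l' < i" "e l' < e i" "e i < e n'"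
      "\<And>k. k < i \<Longrightarrow> \<not> (e l' < e k \<and> e k < e n')"
      unfolding nested_def by blast
    have "n < i"
      using m' mi by (simp add: N'_def)
    then have "e l' = e n"
      using n'(5)[of n] i(3)[of l'] n'(2,3,4) i(1,2) by linarith
    moreover have "e n' = e m"
      using n'(5)[of m] i(3)[of n'] n'(1-4) i(1,2) mi by linarith
    ultimately have "l' = n" "n' = m"
      using inj by (auto dest: injD)
    then show False
      using n'(1) m' by (simp add: N'_def)
  qed
  moreover have "\<not> (e n < e k \<and> e k < e i)" if "k < i" for k
    using i(2) i(3)[OF that] by linarith
  ultimately show thesis
    using i(1) by (intro that[of i]) (auto simp: N'_def)
qed

text \<open>A value smaller than all earlier ones has no lower neighbour, so it is not
  \<open>nested\<close>; its level will hug \<open>F\<close> itself.\<close>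

lemma ex_late_minimum:
  obtains i where "N \<le> i" "\<And>k. k < i \<Longrightarrow> \<not> e k < e i" "\<not> nested e i"
proof -
  obtain b where b: "b \<le> c" "0 < b" "\<And>k. k < N \<Longrightarrow> \<not> (0 < e k \<and> e k < b)"
    using ex_gap_above[OF c_pos] by metis
  obtain i where i: "0 < e i" "e i < b" "\<And>k. k < i \<Longrightarrow> \<not> (0 < e k \<and> e k < b)"
    using ex_first_between[of 0 b] b(1,2) by (metis order_refl)
  have "\<not> e k < e i" if "k < i" for k
    using i(3)[OF that] i(2) e_pos[of k] by linarith
  moreover have "N \<le> i"
    using b(3) i(1,2) by (meson not_le)
  ultimately show thesis
    by (intro that[of i]) (auto simp: nested_def)
qed

end

text \<open>With \<open>c\<close> irrational, every positive rational up to and including the bound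
  \<open>c\<close> is some \<open>e n\<close>.\<close>

lemma ex_rational_dense_enumeration:
  obtains e :: "nat \<Rightarrow> real" and c where "dense_enumeration e c" "c < 1" "c \<notin> \<rat>"
    "range e = {0<..<c} \<inter> \<rat>"
proof -
  have "\<not> {0<..<1::real} \<subseteq> \<rat>"
    using uncountable_open_interval[of 0 "1::real"] countable_rat countable_subset by force
  then obtain c :: real where c: "0 < c" "c < 1" "c \<notin> \<rat>"
    by (meson greaterThanLessThan_iff subsetI)
  define R where "R = {0<..<c} \<inter> \<rat>"
  have between: "\<exists>r\<in>R. a < r \<and> r < b" if "0 \<le> a" "a < b" "b \<le> c" for a b
    using Rats_dense_in_real[OF that(2)] that(1,3) by (auto simp: R_def)
  have "countable R"
    using countable_rat by (auto simp: R_def)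
  moreover have "infinite R"
  proof
    assume "finite R"
    moreover have "R \<noteq> {}"
      using between[of 0 c] c by auto
    ultimately have "Min R \<in> R" "\<And>r. r \<in> R \<Longrightarrow> Min R \<le> r"
      by auto
    then show False
      using between[of 0 "Min R"] by (fastforce simp: R_def)
  qed
  ultimately have bij: "bij_betw (from_nat_into R) UNIV R"
    by (rule bij_betw_from_nat_into)
  then have range: "range (from_nat_into R) = R"
    by (simp add: bij_betw_def)
  then have "from_nat_into R n \<in> R" for n
    by blast
  then have "dense_enumeration (from_nat_into R) c"
    using bij between range
    by unfold_locales (auto simp: bij_betw_def R_def intro: inj_onI, metis imageE)
  then show thesis
    using c range that by (simp add: R_def)
qed

section \<open>Urysohn families with prescribed levels\<close>

context compact_with_base
begin

text \<open>For closed \<open>C\<close> these open neighbourhoods decrease to \<open>C\<close> as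
  \<open>n\<close> grows. They prescribe how tightly stage \<open>n\<close> hugs an older
  level.\<close>

definition outer :: "nat \<Rightarrow> 'a set \<Rightarrow> 'a set" where
  "outer n C = topspace X - (\<Union>i\<in>{i. i < n \<and> X closure_of B i \<inter> C = {}}. X closure_of B i)"

lemma openin_outer: "openin X (outer n C)"
  unfolding outer_def by (intro openin_diff openin_topspace closedin_Union) auto

lemma subset_outer: "C \<subseteq> topspace X \<Longrightarrow> C \<subseteq> outer n C"
  unfolding outer_def by blast

lemma eventually_notin_outer:
  assumes "closedin X C" "x \<in> topspace X" "x \<notin> C"
  shows "\<exists>N. \<forall>n\<ge>N. x \<notin> outer n C"
proof -
  obtain i where i: "x \<in> B i" "X closure_of B i \<subseteq> topspace X - C"
    using base[of "topspace X - C" x] assms by blast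
  then have "x \<in> X closure_of B i" "X closure_of B i \<inter> C = {}"
    using base_subset_closure by blast+
  then have "x \<notin> outer n C" if "Suc i \<le> n" for n
    using that by (auto simp: outer_def)
  then show ?thesis
    by blast
qed

end

text \<open>In a monotone family this is the \<open>D i\<close> of the lower neighbour of
  \<open>e n\<close> at stage \<open>n\<close>, or \<open>F\<close> if there is none; likewise
  \<open>upper_inter\<close> is the \<open>U i\<close> of the upper neighbour, or the whole
  space.\<close>

definition lower_union :: "(nat \<Rightarrow> 'a set) \<Rightarrow> (nat \<Rightarrow> real) \<Rightarrow> 'a set \<Rightarrow> nat \<Rightarrow> 'a set" where
  "lower_union D e F n = F \<union> (\<Union>i\<in>{i. i < n \<and> e i < e n}. D i)"

definition upper_inter :: "'a topology \<Rightarrow> (nat \<Rightarrow> 'a set) \<Rightarrow> (nat \<Rightarrow> real) \<Rightarrow> nat \<Rightarrow> 'a set" where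
  "upper_inter X U e n = topspace X \<inter> (\<Inter>i\<in>{i. i < n \<and> e n < e i}. U i)"

context partitioned_compact_space
begin

text \<open>The absorbed piece \<open>M\<close> is removed from \<open>U\<close> and added to
  \<open>D\<close>, which preserves the other demands. It is closed because it is adapted and lies
  in finitely many \<open>L i\<close>. This uses that \<open>C\<close> is adapted, so
  \<open>b\<close> will be false at stages without a lower neighbour, where \<open>C\<close> is
  \<open>F\<close>.\<close>

lemma ex_absorbing_partition:
  assumes C: "closedin X C" and G: "openin X G" and CG: "C \<subseteq> G"
    and aG: "adapted_to X L G" and aC: "b \<Longrightarrow> adapted_to X L C"
  shows "\<exists>U D. openin X U \<and> closedin X D \<and> C \<subseteq> U \<and> U \<subseteq> D \<and> D \<subseteq> G \<and> D - U \<subseteq> (\<Union>i. L i) \<and>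
     adapted_to X L U \<and> adapted_to X L D \<and>
     (b \<longrightarrow> (\<Union>i\<le>n. L i) \<inter> G - C \<subseteq> D - U) \<and>
     (up \<longrightarrow> topspace X - outer n (topspace X - G) \<subseteq> D) \<and> (\<not> up \<longrightarrow> U \<subseteq> outer n C)"
proof -
  define M where "M = (if b then (\<Union>i\<le>n. L i) \<inter> G - C else {})"
  have aM: "adapted_to X L M"
    unfolding M_def using aG aC
    by (auto intro!: adapted_to_Diff adapted_to_Int adapted_to_UN adapted_to_member adapted_to_empty
        closedin_L disjoint_L)
  have "M = (\<Union>i\<le>n. M \<inter> L i)"
    by (auto simp: M_def)
  moreover have "closedin X (\<Union>i\<le>n. M \<inter> L i)"
    using aM by (intro closedin_Union) (auto simp: adapted_to_def)
  ultimately have M: "closedin X M"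
    by simp
  have MC: "M \<inter> C = {}" "M \<subseteq> G" "M \<subseteq> (\<Union>i. L i)"
    by (auto simp: M_def)
  have GX: "G \<subseteq> topspace X"
    using G by (rule openin_subset)
  have "\<exists>U D. openin X U \<and> closedin X D \<and> C \<subseteq> U \<and> U \<subseteq> D \<and> D \<subseteq> G \<and> D - U \<subseteq> (\<Union>i. L i) \<and>
     adapted_to X L U \<and> adapted_to X L D \<and>
     (up \<longrightarrow> topspace X - outer n (topspace X - G) \<subseteq> D) \<and> (\<not> up \<longrightarrow> U \<subseteq> outer n C)"
  proof (cases up)
    case True
    \<comment> \<open>To hug \<open>G\<close>, enlarge the closed side; to hug \<open>C\<close>, in
      the other case, shrink the open side to \<open>outer n C\<close>.\<close>
    define C' where "C' = C \<union> (topspace X - outer n (topspace X - G))"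
    have "closedin X C'"
      unfolding C'_def using C openin_outer by (intro closedin_Un closedin_diff closedin_topspace) auto
    moreover have "C' \<subseteq> G"
      using CG subset_outer[of "topspace X - G" n] by (auto simp: C'_def)
    ultimately obtain U D where "openin X U \<and> closedin X D \<and> C' \<subseteq> U \<and> U \<subseteq> D \<and> D \<subseteq> G \<and>
        D - U \<subseteq> (\<Union>i. L i) \<and> adapted_to X L U \<and> adapted_to X L D"
      using ex_adapted_partition[of C' G] G by blast
    with True show ?thesis
      by (intro exI[of _ U] exI[of _ D]) (auto simp: C'_def)
  next
    case False
    have "openin X (G \<inter> outer n C)" "C \<subseteq> G \<inter> outer n C"
      using G openin_outer CG subset_outer[of C n] closedin_subset[OF C] by auto
    then obtain U D where "openin X U \<and> closedin X D \<and> C \<subseteq> U \<and> U \<subseteq> D \<and> D \<subseteq> G \<inter> outer n C \<and>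
        D - U \<subseteq> (\<Union>i. L i) \<and> adapted_to X L U \<and> adapted_to X L D"
      using ex_adapted_partition[of C "G \<inter> outer n C"] C by blast
    with False show ?thesis
      by (intro exI[of _ U] exI[of _ D]) auto
  qed
  then obtain U D where UD: "openin X U" "closedin X D" "C \<subseteq> U" "U \<subseteq> D" "D \<subseteq> G"
     "D - U \<subseteq> (\<Union>i. L i)" "adapted_to X L U" "adapted_to X L D"
     "up \<longrightarrow> topspace X - outer n (topspace X - G) \<subseteq> D" "\<not> up \<longrightarrow> U \<subseteq> outer n C"
    by blast
  show ?thesis
  proof (rule exI[of _ "U - M"], rule exI[of _ "D \<union> M"], intro conjI)
    show "openin X (U - M)" "closedin X (D \<union> M)"
      using UD(1,2) M by (auto intro: closedin_Un)
    show "adapted_to X L (U - M)" "adapted_to X L (D \<union> M)"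
      using UD(7,8) aM by (auto intro: adapted_to_Diff adapted_to_Un)
    show "C \<subseteq> U - M" "U - M \<subseteq> D \<union> M" "D \<union> M \<subseteq> G"
      using UD(3-5) MC(1,2) by auto
    show "D \<union> M - (U - M) \<subseteq> (\<Union>i. L i)"
      using UD(6) MC(3) by blast
    show "b \<longrightarrow> (\<Union>i\<le>n. L i) \<inter> G - C \<subseteq> D \<union> M - (U - M)"
      by (auto simp: M_def)
    show "up \<longrightarrow> topspace X - outer n (topspace X - G) \<subseteq> D \<union> M" "\<not> up \<longrightarrow> U - M \<subseteq> outer n C"
      using UD(9,10) by auto
  qed
qed

text \<open>Stage \<open>n\<close> fits the level of value \<open>e n\<close> between its neighbours
  by \<open>ex_absorbing_partition\<close>; \<open>up\<close> tells which of them it hugs.\<close>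

lemma ex_urysohn_family:
  fixes e :: "nat \<Rightarrow> real" and up :: "nat \<Rightarrow> bool"
  assumes F: "closedin X F"
  obtains U D :: "nat \<Rightarrow> 'a set" where "\<And>n. openin X (U n)" "\<And>n. closedin X (D n)"
    "\<And>n. F \<subseteq> U n" "\<And>n. U n \<subseteq> D n" "\<And>n. D n - U n \<subseteq> (\<Union>i. L i)"
    "\<And>i j. e i < e j \<Longrightarrow> D i \<subseteq> U j"
    "\<And>n k. k < n \<Longrightarrow> e k < e n \<Longrightarrow>
       (\<Union>i\<le>n. L i) \<inter> upper_inter X U e n - lower_union D e F n \<subseteq> D n - U n"
    "\<And>n. up n \<Longrightarrow> topspace X - outer n (topspace X - upper_inter X U e n) \<subseteq> D n"
    "\<And>n. \<not> up n \<Longrightarrow> U n \<subseteq> outer n (lower_union D e F n)"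
proof -
  define below where "below f n = lower_union (\<lambda>i. snd (f i)) e F n" for f :: "nat \<Rightarrow> 'a set \<times> 'a set" and n
  define above where "above f n = upper_inter X (\<lambda>i. fst (f i)) e n" for f :: "nat \<Rightarrow> 'a set \<times> 'a set" and n
  define good where "good f n z \<longleftrightarrow> openin X (fst z) \<and> closedin X (snd z) \<and> below f n \<subseteq> fst z \<and>
     fst z \<subseteq> snd z \<and> snd z \<subseteq> above f n \<and> snd z - fst z \<subseteq> (\<Union>i. L i) \<and>
     adapted_to X L (fst z) \<and> adapted_to X L (snd z) \<and>
     ((\<exists>k<n. e k < e n) \<longrightarrow> (\<Union>i\<le>n. L i) \<inter> above f n - below f n \<subseteq> snd z - fst z) \<and>
     (up n \<longrightarrow> topspace X - outer n (topspace X - above f n) \<subseteq> snd z) \<and>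
     (\<not> up n \<longrightarrow> fst z \<subseteq> outer n (below f n))" for f :: "nat \<Rightarrow> 'a set \<times> 'a set" and n z
  \<comment> \<open>Of two levels, the one built later was fitted to the earlier one, through
    \<open>below\<close> or through \<open>above\<close>.\<close>
  have chain: "snd (f i) \<subseteq> fst (f j)" if "i < n" "j < n" "e i < e j" "\<And>k. k < n \<Longrightarrow> good f k (f k)"
    for f n i j
  proof (cases "i < j")
    case True
    then have "snd (f i) \<subseteq> below f j"
      using that(3) by (auto simp: below_def lower_union_def)
    also have "\<dots> \<subseteq> fst (f j)"
      using that(4)[OF that(2)] unfolding good_def by blast
    finally show ?thesis .
  next
    case False
    then have "j < i"
      using that(3) by (metis linorder_neqE_nat less_irrefl)
    then have "above f i \<subseteq> fst (f j)"
      using that(3) by (auto simp: above_def upper_inter_def)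
    moreover have "snd (f i) \<subseteq> above f i"
      using that(4)[OF that(1)] unfolding good_def by blast
    ultimately show ?thesis
      by blast
  qed
  have "\<exists>f. \<forall>n. good f n (f n)"
  proof (rule dependent_wf_choice[OF wf])
    fix f g :: "nat \<Rightarrow> 'a set \<times> 'a set" and n z
    assume "\<And>i. (i, n) \<in> {(x, y). x < y} \<Longrightarrow> f i = g i"
    then have "below f n = below g n" "above f n = above g n"
      by (auto simp: below_def above_def lower_union_def upper_inter_def)
    then show "good f n z = good g n z"
      by (simp add: good_def)
  next
    fix n f assume "\<And>i. (i, n) \<in> {(x, y). x < y} \<Longrightarrow> good f i (f i)"
    then have IH: "good f i (f i)" if "i < n" for i
      using that by simp
    have IH': "openin X (fst (f i))" "closedin X (snd (f i))" "below f i \<subseteq> fst (f i)"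
      "fst (f i) \<subseteq> snd (f i)" "adapted_to X L (fst (f i))" "adapted_to X L (snd (f i))" if "i < n" for i
      using IH[OF that] by (simp_all add: good_def)
    have F_sub: "F \<subseteq> fst (f i)" "F \<subseteq> snd (f i)" if "i < n" for i
      using IH'(3,4)[OF that] by (auto simp: below_def lower_union_def)
    have below: "closedin X (below f n)"
      unfolding below_def lower_union_def
      using IH'(2) F by (intro closedin_Un closedin_Union) auto
    have above: "openin X (above f n)"
      unfolding above_def upper_inter_def
      using IH'(1) by (intro openin_Int_Inter) auto
    have "snd (f i) \<subseteq> fst (f j)" if "i < n" "e i < e n" "j < n" "e n < e j" for i j
      using that by (intro chain[of i n j f] IH) auto
    then have sub: "below f n \<subseteq> above f n"
      using F_sub closedin_subset[OF F] closedin_subset[OF IH'(2)]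
      unfolding below_def above_def lower_union_def upper_inter_def by blast
    have a_above: "adapted_to X L (above f n)"
      unfolding above_def upper_inter_def using IH'(5) by (intro adapted_to_INT closedin_L) auto
    \<comment> \<open>\<open>F\<close> itself is not known to be adapted, but once a lower level
      exists its \<open>D\<close> contains \<open>F\<close>, and a finite union of adapted sets
      remains.\<close>
    have a_below: "adapted_to X L (below f n)" if "\<exists>k<n. e k < e n"
    proof -
      have "below f n = (\<Union>i\<in>{i. i < n \<and> e i < e n}. snd (f i))"
        using that F_sub(2) unfolding below_def lower_union_def by blast
      moreover have "adapted_to X L (\<Union>i\<in>{i. i < n \<and> e i < e n}. snd (f i))"
        using IH'(6) by (intro adapted_to_UN closedin_L) auto
      ultimately show ?thesis
        by simp
    qed
    obtain U D where "good f n (U, D)"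
      unfolding good_def fst_conv snd_conv
      using ex_absorbing_partition[of "below f n" "above f n" "\<exists>k<n. e k < e n" n "up n",
          OF below above sub a_above a_below] by metis
    then show "\<exists>z. good f n z" ..
  qed
  then obtain f where f: "\<And>n. good f n (f n)"
    by blast
  define U where "U = (\<lambda>i. fst (f i))"
  define D where "D = (\<lambda>i. snd (f i))"
  have UD: "openin X (U n)" "closedin X (D n)" "lower_union D e F n \<subseteq> U n" "U n \<subseteq> D n"
    "D n - U n \<subseteq> (\<Union>i. L i)"
    "(\<exists>k<n. e k < e n) \<Longrightarrow> (\<Union>i\<le>n. L i) \<inter> upper_inter X U e n - lower_union D e F n \<subseteq> D n - U n"
    "up n \<Longrightarrow> topspace X - outer n (topspace X - upper_inter X U e n) \<subseteq> D n"
    "\<not> up n \<Longrightarrow> U n \<subseteq> outer n (lower_union D e F n)" for n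
    using f[of n] unfolding good_def below_def above_def U_def D_def by blast+
  show thesis
  proof (rule that[of U D])
    show "F \<subseteq> U n" for n
      using UD(3)[of n] by (simp add: lower_union_def)
    show "D i \<subseteq> U j" if "e i < e j" for i j
      using chain[of i "Suc (max i j)" j f] that f by (simp add: U_def D_def less_Suc_eq_le)
    show "(\<Union>i\<le>n. L i) \<inter> upper_inter X U e n - lower_union D e F n \<subseteq> D n - U n"
      if "k < n" "e k < e n" for n k
      using UD(6)[of n] that by blast
  qed (use UD in auto)
qed

end

section \<open>Functions with rational levels and the embedding\<close>

context partitioned_compact_space
begin

text \<open>\<open>h\<close> is the infimum of the values whose \<open>U n\<close> contains the
  point. As every level is approached from both sides, \<open>U n\<close> and \<open>D n\<close> are
  exactly the sets where \<open>h < e n\<close> and \<open>h \<le> e n\<close>, so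
  \<open>D n - U n\<close> is the level set at \<open>e n\<close>.\<close>

lemma ex_rational_level_function:
  assumes F: "closedin X F"
  shows "\<exists>h. continuous_map X euclideanreal h \<and>
    (\<forall>x\<in>topspace X. 0 \<le> h x \<and> h x \<le> 1 \<and> (h x = 0 \<longleftrightarrow> x \<in> F) \<and>
       (x \<in> F \<or> (h x \<in> \<rat> \<longleftrightarrow> x \<in> (\<Union>i. L i))))"
proof -
  obtain e c where e: "dense_enumeration e c" and c: "c < 1" "c \<notin> \<rat>" and range: "range e = {0<..<c} \<inter> \<rat>"
    by (rule ex_rational_dense_enumeration)
  interpret dense_enumeration e c
    by (rule e)
  obtain U D :: "nat \<Rightarrow> 'a set" where U: "\<And>n. openin X (U n)" and D: "\<And>n. closedin X (D n)"
    and FU: "\<And>n. F \<subseteq> U n" and UD: "\<And>n. U n \<subseteq> D n" and UDL: "\<And>n. D n - U n \<subseteq> (\<Union>i. L i)"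
    and mono: "\<And>i j. e i < e j \<Longrightarrow> D i \<subseteq> U j"
    and absorb: "\<And>n k. k < n \<Longrightarrow> e k < e n \<Longrightarrow>
       (\<Union>i\<le>n. L i) \<inter> upper_inter X U e n - lower_union D e F n \<subseteq> D n - U n"
    and up: "\<And>n. nested e n \<Longrightarrow> topspace X - outer n (topspace X - upper_inter X U e n) \<subseteq> D n"
    and down: "\<And>n. \<not> nested e n \<Longrightarrow> U n \<subseteq> outer n (lower_union D e F n)"
    using ex_urysohn_family[OF F, of e "nested e"] by blast
  have UX: "U n \<subseteq> topspace X" for n
    using U by (rule openin_subset)
  have UU: "U i \<subseteq> U j" if "e i \<le> e j" for i j
    using mono[of i j] UD[of i] that inj by (cases "e i = e j") (auto dest: injD)
  have DD: "D i \<subseteq> D j" if "e i \<le> e j" for i j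
    using mono[of i j] UD[of j] that inj by (cases "e i = e j") (auto dest: injD)

  \<comment> \<open>For a late \<open>nested\<close> \<open>i\<close> with upper neighbour
    \<open>e n\<close>, \<open>D i\<close> contains all of \<open>U n\<close> outside a
    neighbourhood of its complement that no longer contains \<open>x\<close>.\<close>
  have open_cut: "\<exists>i. e i < e n \<and> x \<in> D i" if x: "x \<in> U n" for x n
  proof -
    obtain N where N: "\<forall>i\<ge>N. x \<notin> outer i (topspace X - U n)"
      using eventually_notin_outer[of "topspace X - U n" x] U[of n] UX[of n] x by blast
    obtain i where i: "N \<le> i" "n < i" "e i < e n" "\<And>k. k < i \<Longrightarrow> \<not> (e i < e k \<and> e k < e n)"
      "nested e i"
      using ex_late_nested_below by metis
    have "U n \<subseteq> U k" if "k < i" "e i < e k" for k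
      using i(4)[OF that(1)] that(2) by (intro UU) linarith
    then have "upper_inter X U e i = U n"
      using i(2,3) UX[of n] unfolding upper_inter_def by blast
    then have "x \<in> D i"
      using up[OF i(5)] N i(1) x UX[of n] by auto
    with i(3) show ?thesis
      by blast
  qed
  \<comment> \<open>Dually, a late \<open>i\<close> with lower neighbour \<open>e n\<close> that is
    not \<open>nested\<close> has \<open>U i\<close> inside \<open>outer i (D n)\<close>.\<close>
  have closed_cut: "\<exists>i. e n < e i \<and> x \<notin> U i" if x: "x \<in> topspace X" "x \<notin> D n" for x n
  proof -
    obtain N where N: "\<forall>i\<ge>N. x \<notin> outer i (D n)"
      using eventually_notin_outer[OF D x] by blast
    obtain i where i: "N \<le> i" "n < i" "e n < e i" "\<And>k. k < i \<Longrightarrow> \<not> (e n < e k \<and> e k < e i)"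
      "\<not> nested e i"
      using ex_late_not_nested_above by metis
    have "D k \<subseteq> D n" if "k < i" "e k < e i" for k
      using i(4)[OF that(1)] that(2) by (intro DD) linarith
    then have "lower_union D e F i = D n"
      using i(2,3) FU[of n] UD[of n] unfolding lower_union_def by blast
    then have "x \<notin> U i"
      using down[OF i(5)] N i(1) by auto
    with i(3) show ?thesis
      by blast
  qed
  have F_cut: "\<exists>i. x \<notin> U i" if x: "x \<in> topspace X" "x \<notin> F" for x
  proof -
    obtain N where N: "\<forall>i\<ge>N. x \<notin> outer i F"
      using eventually_notin_outer[OF F x] by blast
    obtain i where i: "N \<le> i" "\<And>k. k < i \<Longrightarrow> \<not> e k < e i" "\<not> nested e i"
      using ex_late_minimum by metis
    have "lower_union D e F i = F"
      using i(2) unfolding lower_union_def by blast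
    then show ?thesis
      using down[OF i(3)] N i(1) by auto
  qed

  \<comment> \<open>\<open>c\<close>, the value outside all \<open>U n\<close>, is irrational because these points miss all \<open>L i\<close>\<close>
  define h where "h x = Inf (insert c {e n |n. x \<in> U n})" for x
  have bdd: "bdd_below (insert c {e n |n. x \<in> U n})" for x
    using e_pos c_pos by (intro bdd_belowI[of _ 0]) (auto intro: less_imp_le)
  have h_nonneg: "0 \<le> h x" for x
    unfolding h_def using e_pos c_pos by (intro cInf_greatest) (auto intro: less_imp_le)
  have h_le_c: "h x \<le> c" for x
    unfolding h_def using bdd by (intro cInf_lower) auto
  have h_le: "h x \<le> e n" if "x \<in> U n" for x n
    unfolding h_def using bdd that by (intro cInf_lower) auto
  have h_ge: "e n \<le> h x" if x: "x \<notin> U n" for x n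
    unfolding h_def
  proof (rule cInf_greatest)
    fix y assume "y \<in> insert c {e n |n. x \<in> U n}"
    then consider "y = c" | m where "y = e m" "x \<in> U m"
      by blast
    then show "e n \<le> y"
    proof cases
      case 1
      then show ?thesis
        using e_less[of n] by simp
    next
      case 2
      then show ?thesis
        using x UU[of m n] by (metis nle_le subsetD)
    qed
  qed simp
  have U_iff: "x \<in> U n \<longleftrightarrow> h x < e n" if "x \<in> topspace X" for x n
  proof
    assume "x \<in> U n"
    then obtain i where i: "e i < e n" "x \<in> D i"
      using open_cut by blast
    \<comment> \<open>Since \<open>D i\<close> lies in \<open>U m\<close>, \<open>h x\<close> is at
      most \<open>e m\<close>; the intermediate value makes the inequality strict.\<close>
    obtain m where "e i < e m" "e m < e n"
      using ex_first_between[of "e i" "e n"] i(1) e_pos[of i] e_less[of n] by (metis less_imp_le)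
    moreover have "h x \<le> e m"
      using h_le mono[OF \<open>e i < e m\<close>] i(2) by blast
    ultimately show "h x < e n"
      by simp
  next
    assume "h x < e n"
    then show "x \<in> U n"
      using h_ge[of x n] by (meson not_le)
  qed
  have D_iff: "x \<in> D n \<longleftrightarrow> h x \<le> e n" if xX: "x \<in> topspace X" for x n
  proof
    assume "x \<in> D n"
    show "h x \<le> e n"
    proof (rule ccontr)
      assume "\<not> h x \<le> e n"
      then obtain m where m: "e n < e m" "e m < h x"
        using ex_first_between[of "e n" "h x"] e_pos[of n] h_le_c[of x] by (metis less_imp_le not_le)
      then show False
        using h_le[of x m] mono[OF m(1)] \<open>x \<in> D n\<close> by force
    qed
  next
    assume "h x \<le> e n"
    show "x \<in> D n"
    proof (rule ccontr)
      assume "x \<notin> D n"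
      then obtain i where "e n < e i" "x \<notin> U i"
        using closed_cut[of x n] xX by blast
      then show False
        using h_ge[of x i] \<open>h x \<le> e n\<close> by simp
    qed
  qed
  have h_zero: "h x = 0 \<longleftrightarrow> x \<in> F" if "x \<in> topspace X" for x
  proof
    assume "h x = 0"
    then show "x \<in> F"
      using F_cut[OF that] h_ge e_pos by (metis not_le)
  next
    assume "x \<in> F"
    show "h x = 0"
    proof (rule ccontr)
      assume "h x \<noteq> 0"
      then obtain m where "e m < h x"
        using ex_first_between[of 0 "h x"] h_nonneg[of x] h_le_c[of x] by (metis order_le_less order_refl)
      then show False
        using h_le[of x m] FU \<open>x \<in> F\<close> by (meson not_le subsetD)
    qed
  qed
  have h_rat: "h x \<in> \<rat>" if xL: "x \<in> L j" "x \<notin> F" for x j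
  proof -
    have xX: "x \<in> topspace X"
      using xL(1) closedin_subset[OF closedin_L] by blast
    have "\<exists>n. h x = e n"
    proof (rule ccontr)
      assume no: "\<nexists>n. h x = e n"
      have "0 < h x"
        using h_zero[OF xX] xL(2) h_nonneg[of x] by force
      then obtain m where m: "e m < h x"
        using ex_first_between[of 0 "h x"] h_le_c[of x] by (metis order_refl)
      \<comment> \<open>From stage \<open>N\<close> on, \<open>L j\<close> is among the sets to be
        absorbed and the lower level of value \<open>e m\<close> is present.\<close>
      define N where "N = Suc (max j m)"
      obtain a where a: "0 \<le> a" "a < h x" "\<And>k. k < N \<Longrightarrow> \<not> (a < e k \<and> e k < h x)"
        using ex_gap_below[OF \<open>0 < h x\<close>] by metis
      \<comment> \<open>If \<open>h x = c\<close> there is no room above, and \<open>b = c\<close>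
        serves because all values lie below \<open>c\<close>.\<close>
      obtain b where b: "h x \<le> b" "b \<le> c" "\<And>k. k < N \<Longrightarrow> \<not> (h x < e k \<and> e k < b)"
      proof (cases "h x < c")
        case True
        obtain b where "b \<le> c" "h x < b" "\<And>k. k < N \<Longrightarrow> \<not> (h x < e k \<and> e k < b)"
          using ex_gap_above[OF True] by metis
        then show thesis
          by (intro that[of b]) auto
      next
        case False
        then show thesis
          using that[of c] h_le_c[of x] e_less by (metis not_less order_refl order_le_less)
      qed
      \<comment> \<open>Every value of smaller index is at most \<open>a\<close> or at least
        \<open>b\<close>, so at stage \<open>n\<close> the point \<open>x\<close> lies between the
        neighbouring levels. It is absorbed there, which forces \<open>h x = e n\<close>.\<close>
      obtain n where n: "a < e n" "e n < b" "\<And>k. k < n \<Longrightarrow> \<not> (a < e k \<and> e k < b)"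
        using ex_first_between[of a b] a(1,2) b(1,2) by (metis order_less_le_trans)
      have "N \<le> n"
        using a(3) b(3) n(1,2) no by (metis not_le linorder_neqE_linordered_idom)
      have "x \<in> U k" if "k < n" "e n < e k" for k
      proof -
        have "h x \<noteq> e k" "b \<le> e k"
          using no n(1,2) n(3)[OF that(1)] that(2) by (blast, linarith)
        then show ?thesis
          using b(1) by (simp add: U_iff[OF xX])
      qed
      then have "x \<in> upper_inter X U e n"
        using xX by (simp add: upper_inter_def)
      moreover have "x \<notin> D k" if "k < n" "e k < e n" for k
        using n(2) n(3)[OF that(1)] that(2) a(2) by (simp add: D_iff[OF xX])
      then have "x \<notin> lower_union D e F n"
        using \<open>x \<notin> F\<close> by (auto simp: lower_union_def)
      moreover have "x \<in> (\<Union>i\<le>n. L i)"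
        using xL(1) \<open>N \<le> n\<close> by (auto simp: N_def)
      moreover have "m < N" "m < n"
        using \<open>N \<le> n\<close> by (auto simp: N_def)
      moreover have "e m < e n"
        using a(3)[OF \<open>m < N\<close>] m n(1) by linarith
      ultimately have "x \<in> D n - U n"
        using absorb[of m n] by blast
      then have "h x = e n"
        by (simp add: D_iff[OF xX] U_iff[OF xX])
      with no show False
        by blast
    qed
    then show ?thesis
      using range by force
  qed
  have h_irrat: "x \<in> (\<Union>i. L i)" if x: "x \<in> topspace X" "x \<notin> F" "h x \<in> \<rat>" for x
  proof -
    have "0 < h x"
      using h_zero[OF x(1)] x(2) h_nonneg[of x] by force
    moreover have "h x < c"
      using h_le_c[of x] c(2) x(3) by (cases "h x = c") auto
    ultimately obtain n where "h x = e n"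
      using range x(3) by (metis IntI greaterThanLessThan_iff imageE)
    then have "x \<in> D n - U n"
      by (simp add: D_iff[OF x(1)] U_iff[OF x(1)])
    then show ?thesis
      using UDL by blast
  qed
  \<comment> \<open>Density is available only within \<open>[0, c]\<close>; bounds \<open>a\<close>
    below \<open>0\<close> here, and above \<open>c\<close> in the dual claim, are treated
    apart.\<close>
  have "openin X {x \<in> topspace X. a < h x}" for a
  proof (cases "a < 0")
    case True
    then have "{x \<in> topspace X. a < h x} = topspace X"
      using h_nonneg by (auto intro: order_less_le_trans)
    then show ?thesis
      by simp
  next
    case False
    have "{x \<in> topspace X. a < h x} = (\<Union>n\<in>{n. a \<le> e n}. topspace X - D n)"
    proof (intro set_eqI iffI)
      fix x assume x: "x \<in> {x \<in> topspace X. a < h x}"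
      then obtain n where "a < e n" "e n < h x"
        using ex_first_between[of a "h x"] False h_le_c[of x] by (metis mem_Collect_eq not_less)
      then show "x \<in> (\<Union>n\<in>{n. a \<le> e n}. topspace X - D n)"
        using x D_iff[of x n] by (auto intro!: exI[of _ n])
    qed (auto simp: D_iff)
    moreover have "openin X (\<Union>n\<in>{n. a \<le> e n}. topspace X - D n)"
      using D by (intro openin_Union) auto
    ultimately show ?thesis
      by simp
  qed
  moreover have "openin X {x \<in> topspace X. h x < a}" for a
  proof (cases "c < a")
    case True
    then have "{x \<in> topspace X. h x < a} = topspace X"
      using h_le_c by (auto intro: order_le_less_trans)
    then show ?thesis
      by simp
  next
    case False
    have "{x \<in> topspace X. h x < a} = (\<Union>n\<in>{n. e n \<le> a}. U n)"
    proof (intro set_eqI iffI)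
      fix x assume x: "x \<in> {x \<in> topspace X. h x < a}"
      then obtain n where "h x < e n" "e n < a"
        using ex_first_between[of "h x" a] False h_nonneg[of x] by (metis mem_Collect_eq not_less)
      then show "x \<in> (\<Union>n\<in>{n. e n \<le> a}. U n)"
        using x U_iff[of x n] by (auto intro!: exI[of _ n])
    next
      fix x assume "x \<in> (\<Union>n\<in>{n. e n \<le> a}. U n)"
      then show "x \<in> {x \<in> topspace X. h x < a}"
        using U_iff UX by force
    qed
    moreover have "openin X (\<Union>n\<in>{n. e n \<le> a}. U n)"
      using U by (intro openin_Union) auto
    ultimately show ?thesis
      by simp
  qed
  ultimately have "continuous_map X euclideanreal h"
    by (simp add: continuous_map_upper_lower_semicontinuous_lt)
  moreover have "h x \<le> 1" for x
    using h_le_c[of x] c(1) by simp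
  moreover have "x \<in> F \<or> (h x \<in> \<rat> \<longleftrightarrow> x \<in> (\<Union>i. L i))" if "x \<in> topspace X" for x
    using h_rat[of x] h_irrat[OF that] by auto
  ultimately show ?thesis
    using h_nonneg h_zero by (intro exI[of _ h]) simp
qed

end

section \<open>Countable bases, F-sigma-delta sets and coordinates\<close>

lemma ex_compact_with_base:
  assumes "compact_space X" "metrizable_space X"
  shows "\<exists>B. compact_with_base X B"
proof -
  obtain M d where "Metric_space M d" and X: "X = Metric_space.mtopology M d"
    using assms(2) unfolding metrizable_space_def by blast
  interpret Metric_space M d
    by fact
  have "mtotally_bounded M"
    using assms(1) by (simp add: X compact_space_eq_mcomplete_mtotally_bounded)
  then have "\<exists>K. finite K \<and> K \<subseteq> M \<and> M \<subseteq> (\<Union>x\<in>K. mball x (1 / Suc n))" for n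
    unfolding mtotally_bounded_def by simp
  then obtain K where K: "\<And>n. finite (K n)" "\<And>n. K n \<subseteq> M" "\<And>n. M \<subseteq> (\<Union>x\<in>K n. mball x (1 / Suc n))"
    by metis
  \<comment> \<open>Balls about finite nets form the base; the empty set is added so that the family
    is nonempty and can be listed by the natural numbers.\<close>
  define \<B> where "\<B> = insert {} (\<Union>n. (\<lambda>x. mball x (1 / Suc n)) ` K n)"
  have "countable \<B>"
    unfolding \<B>_def using K(1) by (intro countable_insert countable_UN) (auto intro: countable_finite)
  then have range: "range (from_nat_into \<B>) = \<B>"
    by (intro range_from_nat_into) (auto simp: \<B>_def)
  have "compact_with_base X (from_nat_into \<B>)"
  proof
    show "compact_space X" "Hausdorff_space X"
      using assms metrizable_imp_Hausdorff_space by auto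
    show "openin X (from_nat_into \<B> n)" for n
    proof -
      have "from_nat_into \<B> n \<in> \<B>"
        using range by blast
      then show ?thesis
        by (auto simp: \<B>_def X)
    qed
    fix U x assume U: "openin X U" "x \<in> U"
    then obtain r where r: "0 < r" "mball x r \<subseteq> U"
      unfolding X openin_mtopology by blast
    obtain n where n: "1 / Suc n < r / 2"
      using r(1) nat_approx_posE[of "r / 2"] by auto
    have "x \<in> M"
      using U openin_subset[of X U] by (auto simp: X)
    then obtain y where y: "y \<in> K n" "x \<in> mball y (1 / Suc n)"
      using K(3)[of n] by blast
    have "X closure_of mball y (1 / Suc n) \<subseteq> mcball y (1 / Suc n)"
      unfolding X by (intro closure_of_minimal mball_subset_mcball closedin_mcball)
    also have "\<dots> \<subseteq> mball x r"
    proof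
      fix z assume z: "z \<in> mcball y (1 / Suc n)"
      then have "d x z \<le> d x y + d y z"
        using y(2) triangle[of x y z] by auto
      also have "\<dots> < r"
        using y(2) z n commute[of x y] by auto
      finally show "z \<in> mball x r"
        using z \<open>x \<in> M\<close> by auto
    qed
    finally have "X closure_of mball y (1 / Suc n) \<subseteq> U"
      using r(2) by blast
    moreover obtain i where "from_nat_into \<B> i = mball y (1 / Suc n)"
      using range y(1) unfolding \<B>_def by (metis (no_types, lifting) UN_I UNIV_I image_eqI insertI2 rangeE)
    ultimately show "\<exists>n. x \<in> from_nat_into \<B> n \<and> X closure_of from_nat_into \<B> n \<subseteq> U"
      using y(2) by metis
  qed
  then show ?thesis
    by (rule exI[of _ "from_nat_into \<B>"])
qed

text \<open>Padding the intersection with \<open>topspace X\<close> and the unions with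
  \<open>{}\<close> lets even an empty family be listed by all natural numbers.\<close>

lemma fsigmadelta_in_eq:
  assumes "fsigmadelta_in X A"
  obtains F :: "nat \<Rightarrow> nat \<Rightarrow> 'a set" where "\<And>k l. closedin X (F k l)"
    "A = topspace X \<inter> (\<Inter>k. \<Union>l. F k l)"
proof -
  obtain \<A> where \<A>: "countable \<A>" "\<And>S. S \<in> \<A> \<Longrightarrow> fsigma_in X S" "A = topspace X \<inter> \<Inter>\<A>"
    using assms unfolding fsigmadelta_in_def relative_to_def intersection_of_def by auto
  define S where "S = from_nat_into (insert (topspace X) \<A>)"
  have S: "range S = insert (topspace X) \<A>"
    unfolding S_def using \<A>(1) by (intro range_from_nat_into) auto
  have "\<exists>G :: nat \<Rightarrow> 'a set. (\<forall>l. closedin X (G l)) \<and> S k = (\<Union>l. G l)" for k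
  proof -
    have "S k \<in> insert (topspace X) \<A>"
      using S by blast
    then have "fsigma_in X (S k)"
      using \<A>(2) by auto
    then obtain \<C> where \<C>: "countable \<C>" "\<And>C. C \<in> \<C> \<Longrightarrow> closedin X C" "\<Union>\<C> = S k"
      unfolding fsigma_in_def union_of_def by auto
    have range: "range (from_nat_into (insert {} \<C>)) = insert {} \<C>"
      using \<C>(1) by (intro range_from_nat_into) auto
    then have "closedin X (from_nat_into (insert {} \<C>) l)" for l
      using \<C>(2) by (metis closedin_empty insertE rangeI)
    moreover have "S k = (\<Union>l. from_nat_into (insert {} \<C>) l)"
      using \<C>(3) range by simp
    ultimately show ?thesis
      by blast
  qed
  then obtain F :: "nat \<Rightarrow> nat \<Rightarrow> 'a set" where F: "\<And>k l. closedin X (F k l)" "\<And>k. S k = (\<Union>l. F k l)"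
    by metis
  have "(\<Inter>k. \<Union>l. F k l) = topspace X \<inter> \<Inter>\<A>"
    using S by (simp add: F(2)[symmetric])
  then show thesis
    using \<A>(3) F(1) by (intro that[of F]) auto
qed

lemma two_power_three_power_inj:
  assumes "2 ^ a * 3 ^ b = (2 ^ c * 3 ^ d :: nat)"
  shows "a = c \<and> b = d"
proof -
  have le: "a \<le> c" if "2 ^ a * 3 ^ b = (2 ^ c * 3 ^ d :: nat)" for a b c d
  proof -
    have "(2 ^ a :: nat) dvd 2 ^ c * 3 ^ d"
      using that by (metis dvd_triv_left)
    moreover have "coprime (2 ^ a :: nat) (3 ^ d)"
      by simp
    ultimately have "(2 ^ a :: nat) dvd 2 ^ c"
      using coprime_dvd_mult_left_iff by blast
    then show ?thesis
      using power_dvd_imp_le by force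
  qed
  have "a = c"
    using le[OF assms] le[OF assms[symmetric]] by simp
  with assms show ?thesis
    by simp
qed

theorem theorem1p3:
  fixes X :: "'a topology" and A :: "'a set"
  assumes "compact_space X" and "metrizable_space X" and "has_covering_dim X 1"
    and "fsigmadelta_in X A"
  shows "\<exists>h. embedding_map X
               (subtopology hilbert_cube (irrational_or_zero_points \<union> rational_points)) h \<and>
             A = {x \<in> topspace X. h x \<in> H}"
proof -
  obtain B where "compact_with_base X B"
    using ex_compact_with_base assms(1,2) by blast
  then interpret compact_with_base X B .
  obtain L where "partitioned_compact_space X B L"
    using ex_partitioned_compact_space assms(3) by (auto simp: has_covering_dim_def)
  then interpret partitioned_compact_space X B L .
  obtain F :: "nat \<Rightarrow> nat \<Rightarrow> 'a set" where F: "\<And>k l. closedin X (F k l)"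
    and A: "A = topspace X \<inter> (\<Inter>k. \<Union>l. F k l)"
    using fsigmadelta_in_eq[OF assms(4)] by blast

  \<comment> \<open>Odd coordinates separate points. The shift by \<open>Suc\<close> turns indices
    from \<open>0\<close> into the positive ones of \<open>H\<close>; at most one pair encodes a
    given \<open>n\<close>, and at even \<open>n\<close> encoding none the intersection is the whole
    space, so the coordinate vanishes identically.\<close>
  define Z where "Z n = (if odd n then X closure_of B (n div 2)
      else \<Inter> (insert (topspace X) ((\<lambda>(k, l). F k l) ` {(k, l). n = 2 ^ Suc k * 3 ^ Suc l})))" for n
  have Z: "closedin X (Z n)" for n
  proof (cases "odd n")
    case True
    then show ?thesis
      by (simp add: Z_def)
  next
    case False
    then have "Z n = \<Inter> (insert (topspace X) ((\<lambda>(k, l). F k l) ` {(k, l). n = 2 ^ Suc k * 3 ^ Suc l}))"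
      by (simp only: Z_def if_False)
    moreover have "closedin X \<dots>"
      using F by (intro closedin_Inter) auto
    ultimately show ?thesis
      by simp
  qed
  have Z_odd: "Z (2 * i + 1) = X closure_of B i" for i
    by (simp add: Z_def)
  have Z_F: "Z (2 ^ Suc k * 3 ^ Suc l) = F k l" for k l
  proof -
    have "{(k', l'). 2 ^ Suc k * 3 ^ Suc l = (2 ^ Suc k' * 3 ^ Suc l' :: nat)} = {(k, l)}"
      using two_power_three_power_inj by blast
    then show ?thesis
      using closedin_subset[OF F[of k l]] by (simp add: Z_def Int_absorb1)
  qed
  have "\<exists>h. \<forall>n. continuous_map X euclideanreal (h n) \<and>
    (\<forall>x\<in>topspace X. 0 \<le> h n x \<and> h n x \<le> 1 \<and> (h n x = 0 \<longleftrightarrow> x \<in> Z n) \<and>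
       (x \<in> Z n \<or> (h n x \<in> \<rat> \<longleftrightarrow> x \<in> (\<Union>i. L i))))"
    using ex_rational_level_function[OF Z] by (intro choice) blast
  then obtain g where g: "\<And>n. continuous_map X euclideanreal (g n)"
    "\<And>n x. x \<in> topspace X \<Longrightarrow> 0 \<le> g n x \<and> g n x \<le> 1"
    "\<And>n x. x \<in> topspace X \<Longrightarrow> g n x = 0 \<longleftrightarrow> x \<in> Z n"
    "\<And>n x. x \<in> topspace X \<Longrightarrow> x \<in> Z n \<or> (g n x \<in> \<rat> \<longleftrightarrow> x \<in> (\<Union>i. L i))"
    by blast
  define h where "h x = (\<lambda>n\<in>{1..}. g n x)" for x
  have h_apply: "h x n = g n x" if "1 \<le> n" for x n
    using that by (simp add: h_def)
  have cont: "continuous_map X hilbert_cube h"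
    unfolding hilbert_cube_def continuous_map_componentwise
  proof (intro conjI ballI)
    show "h ` topspace X \<subseteq> extensional {1..}"
      by (auto simp: h_def)
    show "continuous_map X (top_of_set {0..1}) (\<lambda>x. h x n)" if "n \<in> {1..}" for n
      using g(1,2) that by (auto simp: h_apply continuous_map_in_subtopology)
  qed
  have inj: "inj_on h (topspace X)"
  proof (rule inj_onI, rule ccontr)
    fix x y assume xy: "x \<in> topspace X" "y \<in> topspace X" "h x = h y" "x \<noteq> y"
    have "closedin X {y}"
      using xy(2) Hausdorff by (simp add: closedin_Hausdorff_singleton)
    then obtain i where i: "x \<in> B i" "X closure_of B i \<subseteq> topspace X - {y}"
      using base[of "topspace X - {y}" x] xy by blast
    have "g (2 * i + 1) x = 0" "g (2 * i + 1) y \<noteq> 0"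
      using g(3)[of x "2 * i + 1"] g(3)[of y "2 * i + 1"] xy(1,2) i base_subset_closure[of i]
      unfolding Z_odd by auto
    moreover have "h x (2 * i + 1) = h y (2 * i + 1)"
      using xy(3) by simp
    ultimately show False
      by (simp add: h_apply)
  qed
  have Haus: "Hausdorff_space hilbert_cube"
    unfolding hilbert_cube_def Hausdorff_space_product_topology by (simp add: Hausdorff_space_subtopology)
  \<comment> \<open>The union of the \<open>L i\<close> is the same for all coordinates, so
    \<open>x\<close> alone decides between rational and irrational; the value \<open>0\<close> is
    allowed on both sides.\<close>
  have "h x \<in> irrational_or_zero_points \<union> rational_points" if x: "x \<in> topspace X" for x
  proof (cases "x \<in> (\<Union>i. L i)")
    case True
    have "g n x \<in> unit_rationals" for n
      using g(2,4)[OF x, of n] g(3)[OF x, of n] True by (auto simp: unit_rationals_def)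
    then show ?thesis
      by (auto simp: rational_points_def h_def)
  next
    case False
    have "g n x \<in> unit_irrationals \<union> {0}" for n
      using g(2,4)[OF x, of n] g(3)[OF x, of n] False by (auto simp: unit_irrationals_def)
    then show ?thesis
      by (auto simp: irrational_or_zero_points_def h_def)
  qed
  then have "embedding_map X
       (subtopology hilbert_cube (irrational_or_zero_points \<union> rational_points)) h"
    using continuous_imp_embedding_map[OF cont assms(1) Haus inj]
    by (auto simp: embedding_map_in_subtopology)
  moreover have "h x \<in> H \<longleftrightarrow> x \<in> A" if x: "x \<in> topspace X" for x
  proof -
    have positive: "{1..} = range Suc"
      using Suc_le_D by (force simp: Suc_le_eq)
    have "h x \<in> topspace hilbert_cube"
      using cont x continuous_map_image_subset_topspace by blast
    then have "h x \<in> H \<longleftrightarrow> (\<forall>k\<in>{1..}. \<exists>l\<in>{1..}. g (2 ^ k * 3 ^ l) x = 0)"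
      by (simp add: H_def Hkl_def h_apply)
    also have "\<dots> \<longleftrightarrow> (\<forall>k. \<exists>l. g (2 ^ Suc k * 3 ^ Suc l) x = 0)"
      unfolding positive by blast
    also have "\<dots> \<longleftrightarrow> x \<in> A"
      unfolding g(3)[OF x] Z_F A using x by blast
    finally show ?thesis .
  qed
  then have "A = {x \<in> topspace X. h x \<in> H}"
    using A by auto
  ultimately show ?thesis
    by blast
qed

end
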